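(* Let $L/K$ be a finite extension, let $L_S/K$ be its maximal separable subextension, and let $A=\mathrm{Aut}(L/K)$ with fixed field $L^A$. (1) $r_K(L)=[L:L^A]$. Also $N=L^A$ is the unique intermediate field $K\subset N\subset L$ such that $L/N$ is Galois of maximum possible degree. (2) $l_K(L_S)=r_K(L_S)$, $r_{L_S}(L)=s_{L_S}(L)=1$ and $l_{L_S}(L)=[L:L_S]$. (3) $r_K(L)\cdot s_K(L)=[L_S:K]$ and $l_K(L)\cdot s_K(L)=[L:K]$. Also $[L^A:K]=[L:L_S]\cdot s_K(L)$. (4) $r_K(L)\mid r_K(L_S)$ and $s_K(L_S)\mid s_K(L)$. (5) If $L/K$ is normal, then: (a) $r_K(L_S)=[L_S:K]$ and $s_K(L_S)=1$; (b) $r_K(L)=r_K(L_S)$, $l_K(L)=[L:K]$ and $s_K(L)=1$; (c) $r_K(L^A)=s_K(L^A)=1$ and $l_K(L^A)=[L^A:K]$.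
   Context: $K$ is any field (not necessarily perfect) with a fixed algebraic closure $\bar K$; all extensions are finite and contained in $\bar K$. For any base field $E$ and finite extension $L/E$: the cluster size is $r_E(L)=|\mathrm{Aut}(L/E)|$; $s_E(L)$ is the number of distinct subfields of $\bar K$ isomorphic to $L$ over $E$; the multicluster size is $l_E(L)=[L:L']\cdot r_E(L)$, where $L'$ is the maximal separable subextension of $L/E$. *)

theory Defs
  imports "HOL-Algebra.Algebraic_Closure"
begin

text \<open>
  The ambient ring \<open>R\<close> is an algebraic closure of the base field; all fields are subsets of its
  carrier, and a subset \<open>L\<close> is turned into a ring by restricting the carrier.
\<close>

definition finite_field_ext :: "('a, 'b) ring_scheme \<Rightarrow> 'a set \<Rightarrow> 'a set \<Rightarrow> bool" where
  "finite_field_ext R E L \<longleftrightarrow>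
     subfield E R \<and> subfield L R \<and> E \<subseteq> L \<and> ring.finite_dimension R E L"

definition intermediate_field :: "('a, 'b) ring_scheme \<Rightarrow> 'a set \<Rightarrow> 'a set \<Rightarrow> 'a set \<Rightarrow> bool" where
  "intermediate_field R E M L \<longleftrightarrow> subfield M R \<and> E \<subseteq> M \<and> M \<subseteq> L"

text \<open>
  Isomorphisms matter only on their domain; \<open>extensional\<close> fixes the values outside it, so that
  automorphisms can be counted.
\<close>

definition iso_over ::
  "('a, 'b) ring_scheme \<Rightarrow> 'a set \<Rightarrow> 'a set \<Rightarrow> 'a set \<Rightarrow> ('a \<Rightarrow> 'a) set" where
  "iso_over R E L M =
     {\<phi> \<in> ring_iso (R\<lparr>carrier := L\<rparr>) (R\<lparr>carrier := M\<rparr>). \<phi> \<in> extensional L \<and> (\<forall>x\<in>E. \<phi> x = x)}"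

definition Aut_over :: "('a, 'b) ring_scheme \<Rightarrow> 'a set \<Rightarrow> 'a set \<Rightarrow> ('a \<Rightarrow> 'a) set" where
  "Aut_over R E L = iso_over R E L L"

definition fixed_field :: "'a set \<Rightarrow> ('a \<Rightarrow> 'a) set \<Rightarrow> 'a set" where
  "fixed_field L A = {x \<in> L. \<forall>\<phi>\<in>A. \<phi> x = x}"

text \<open>
  Separability of an element: its minimal polynomial has only simple roots in \<open>R\<close>.  This is the
  usual notion because \<open>R\<close> is algebraically closed wherever it is used.
\<close>

definition separable_element :: "('a, 'b) ring_scheme \<Rightarrow> 'a set \<Rightarrow> 'a \<Rightarrow> bool" where
  "separable_element R E x \<longleftrightarrow>
     \<not> ring.transcendental R E x \<and> (\<forall>a\<in>carrier R. ring.alg_mult R (ring.Irr R E x) a \<le> 1)"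

definition separable_ext :: "('a, 'b) ring_scheme \<Rightarrow> 'a set \<Rightarrow> 'a set \<Rightarrow> bool" where
  "separable_ext R E L \<longleftrightarrow> (\<forall>x\<in>L. separable_element R E x)"

text \<open>
  Splitting over \<open>L\<close> is \<open>splitted\<close> taken in the field \<open>L\<close> itself.  The library's \<open>splitted_on\<close> is
  unsuitable: it intersects the multiset of roots with \<open>mset_set L\<close>, which is empty for infinite \<open>L\<close>
  and ignores multiplicities otherwise.
\<close>

definition normal_ext :: "('a, 'b) ring_scheme \<Rightarrow> 'a set \<Rightarrow> 'a set \<Rightarrow> bool" where
  "normal_ext R E L \<longleftrightarrow>
     (\<forall>x\<in>L. \<not> ring.transcendental R E x) \<and>
     (\<forall>p \<in> carrier (univ_poly R E).
        pirreducible\<^bsub>R\<^esub> E p \<longrightarrow> (\<exists>x\<in>L. ring.eval R p x = \<zero>\<^bsub>R\<^esub>) \<longrightarrow> ring.splitted (R\<lparr>carrier := L\<rparr>) p)"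

definition galois_ext :: "('a, 'b) ring_scheme \<Rightarrow> 'a set \<Rightarrow> 'a set \<Rightarrow> bool" where
  "galois_ext R E L \<longleftrightarrow> normal_ext R E L \<and> separable_ext R E L"

text \<open>\<open>GREATEST\<close> refers to inclusion of subsets.\<close>

definition max_separable :: "('a, 'b) ring_scheme \<Rightarrow> 'a set \<Rightarrow> 'a set \<Rightarrow> 'a set" where
  "max_separable R E L = (GREATEST M. intermediate_field R E M L \<and> separable_ext R E M)"

definition cluster_size :: "('a, 'b) ring_scheme \<Rightarrow> 'a set \<Rightarrow> 'a set \<Rightarrow> nat" where
  "cluster_size R E L = card (Aut_over R E L)"

definition num_conjugates :: "('a, 'b) ring_scheme \<Rightarrow> 'a set \<Rightarrow> 'a set \<Rightarrow> nat" where
  "num_conjugates R E L = card {M. subfield M R \<and> E \<subseteq> M \<and> iso_over R E L M \<noteq> {}}"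

definition multicluster_size :: "('a, 'b) ring_scheme \<Rightarrow> 'a set \<Rightarrow> 'a set \<Rightarrow> nat" where
  "multicluster_size R E L = ring.dim R (max_separable R E L) L * cluster_size R E L"

end

(*
  Let emb(E/K) be the set of K-embeddings of E into the algebraic closure C.  Its cardinality is
  multiplicative in towers: inside a finite extension N of K stable under all embeddings, emb(N/K)
  is a group, every embedding of an intermediate field extends to N, and the fibres of restriction
  to M are cosets of emb(N/M).  For a simple extension it counts the distinct roots of the minimal
  polynomial, so card emb(E/K) <= [E:K], with equality exactly for separable extensions; this makes
  the separable elements a subfield E_S and makes separability transitive.  An element inseparable
  over K has a minimal polynomial with zero derivative, hence a polynomial in X^p, and injectivity
  of the Frobenius map gives card emb(E/E_S) = 1.  So card emb(E/K) = [E_S:K].  Grouping embeddings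
  by their image gives card emb(E/K) = r_K(E) * s_K(E), and Artin's theorem gives r_K(E) = [E:E^A];
  the remaining claims are arithmetic, apart from r_K(E) | r_K(E_S), which is Lagrange's theorem for
  the injective restriction Aut(E/K) -> Aut(E_S/K).
*)

theory Submission
  imports Defs "HOL-Algebra.Bij" "HOL-Computational_Algebra.Primes"
begin

section \<open>Field homomorphisms and their extension\<close>

text \<open>Automorphisms alone are a poor counting device: a field that is not normal may have too
  few of them, and they need not restrict to a subfield. Embeddings into the closure always restrict
  and always extend, so their number behaves well in towers. The coset argument still needs
  inverses, hence the detour through an overfield \<open>N\<close> that every embedding maps onto
  itself. An inseparable extension may require several generators, so the number of embeddings and
  the degree are compared one generator at a time. The vanishing derivative comes from a multiple
  root by evaluation in the dual numbers, whose multiplicativity does the work of the product rule.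
  The prime of the Frobenius map is the characteristic; it exists because the degree of an
  inseparable minimal polynomial annihilates \<open>\<one>\<close>. Two claims are not arithmetic:
  that L^A is the unique optimum in (1), which comes from comparing Aut(L/N) with A, and (5c), which
  holds because every embedding of L^A extends to an automorphism of L when L is normal.\<close>

definition embeddings :: "('a, 'b) ring_scheme \<Rightarrow> 'a set \<Rightarrow> 'a set \<Rightarrow> ('a \<Rightarrow> 'a) set" where
  "embeddings R K E =
     {\<phi> \<in> ring_hom (R\<lparr>carrier := E\<rparr>) R. \<phi> \<in> extensional E \<and> (\<forall>x\<in>K. \<phi> x = x)}"

lemma embeddingsD:
  assumes "\<phi> \<in> embeddings R K E"
  shows "\<phi> \<in> ring_hom (R\<lparr>carrier := E\<rparr>) R" "\<phi> \<in> extensional E" "\<And>x. x \<in> K \<Longrightarrow> \<phi> x = x"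
  using assms by (auto simp: embeddings_def)

section \<open>Arithmetic of a homomorphism defined on a subfield\<close>

context field
begin

context
  fixes E h
  assumes E: "subfield E R" and h: "h \<in> ring_hom (R\<lparr>carrier := E\<rparr>) R"
begin

lemma subfield_hom_ring: "ring_hom_ring (R\<lparr>carrier := E\<rparr>) R h"
  by (rule ring_hom_ringI2[OF subring_is_ring[OF subfieldE(1)[OF E]] ring_axioms h])

lemma subfield_hom_closed: "x \<in> E \<Longrightarrow> h x \<in> carrier R"
  using ring_hom_memE(1)[OF h] by simp

lemma subfield_hom_mult: "x \<in> E \<Longrightarrow> y \<in> E \<Longrightarrow> h (x \<otimes> y) = h x \<otimes> h y"
  using ring_hom_memE(2)[OF h] by simp

lemma subfield_hom_add: "x \<in> E \<Longrightarrow> y \<in> E \<Longrightarrow> h (x \<oplus> y) = h x \<oplus> h y"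
  using ring_hom_memE(3)[OF h] by simp

lemma subfield_hom_one: "h \<one> = \<one>"
  using ring_hom_memE(4)[OF h] by simp

lemma subfield_hom_zero: "h \<zero> = \<zero>"
  using ring_hom_zero[OF h subring_is_ring[OF subfieldE(1)[OF E]] ring_axioms] by simp

lemma subfield_hom_uminus:
  assumes "x \<in> E" shows "h (\<ominus> x) = \<ominus> h x"
proof -
  have "\<ominus> x \<in> E" "x \<in> carrier R"
    using assms subringE(5)[OF subfieldE(1)[OF E]] subfieldE(3)[OF E] by auto
  then have "h (\<ominus> x) \<oplus> h x = \<zero>"
    using subfield_hom_add[of "\<ominus> x" x] assms l_neg subfield_hom_zero by simp
  then show ?thesis
    using minus_equality[of "h (\<ominus> x)" "h x"] subfield_hom_closed assms \<open>\<ominus> x \<in> E\<close> by auto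
qed

text \<open>A field has no proper nonzero ideals, so every homomorphism out of it is injective; this
  is why \<open>embeddings\<close> carries no injectivity clause.\<close>

lemma subfield_hom_inj: "inj_on h E"
  and subfield_hom_image: "subfield (h ` E) R"
proof -
  interpret H: ring_hom_ring "R\<lparr>carrier := E\<rparr>" R h
    by (rule subfield_hom_ring)
  have "subfield E (R\<lparr>carrier := E\<rparr>)"
    using field.carrier_is_subfield[OF subfield_iff(2)[OF E]] by simp
  then show "inj_on h E" "subfield (h ` E) R"
    using H.img_is_subfield by auto
qed

lemma subfield_hom_eq_zero_iff: "x \<in> E \<Longrightarrow> h x = \<zero> \<longleftrightarrow> x = \<zero>"
  using inj_onD[OF subfield_hom_inj, of x \<zero>] subringE(2)[OF subfieldE(1)[OF E]] subfield_hom_zero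
  by auto

lemma subfield_hom_eval:
  assumes "set p \<subseteq> E" "x \<in> E"
  shows "h (eval p x) = eval (map h p) (h x)"
proof -
  interpret H: ring_hom_ring "R\<lparr>carrier := E\<rparr>" R h
    by (rule subfield_hom_ring)
  show ?thesis
    using H.eval_hom'[of x p] assms eval_consistent[OF subfieldE(1)[OF E]] by simp
qed

lemma subfield_hom_map_polynomial:
  assumes "p \<in> carrier (E[X])"
  shows "map h p \<in> carrier (poly_ring R)"
proof (cases p)
  case Nil
  then show ?thesis by (simp add: univ_poly_zero_closed)
next
  case (Cons a q)
  then have "a \<in> E" "set q \<subseteq> E" "a \<noteq> \<zero>"
    using assms unfolding sym[OF univ_poly_carrier] polynomial_def by auto
  then show ?thesis
    using Cons subfield_hom_closed subfield_hom_eq_zero_iff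
    unfolding sym[OF univ_poly_carrier] polynomial_def by auto
qed

lemma subfield_hom_preimage_subring:
  assumes "subring F R"
  shows "subring {x \<in> E. h x \<in> F} R"
proof (rule subringI)
  note sE = subringE[OF subfieldE(1)[OF E]] and sF = subringE[OF assms]
  show "{x \<in> E. h x \<in> F} \<subseteq> carrier R" using sE(1) by auto
  show "\<one> \<in> {x \<in> E. h x \<in> F}" using sE(3) sF(3) subfield_hom_one by simp
  fix x assume x: "x \<in> {x \<in> E. h x \<in> F}"
  show "\<ominus> x \<in> {x \<in> E. h x \<in> F}"
    using x sE(5) sF(5) subfield_hom_uminus by simp
  fix y assume y: "y \<in> {x \<in> E. h x \<in> F}"
  show "x \<otimes> y \<in> {x \<in> E. h x \<in> F}"
    using x y sE(6) sF(6) subfield_hom_mult by simp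
  show "x \<oplus> y \<in> {x \<in> E. h x \<in> F}"
    using x y sE(7) sF(7) subfield_hom_add by simp
qed

end

text \<open>Serves two purposes: for two embeddings it reduces equality to equality on generators,
  and with \<open>g\<close> the identity it shows that the fixed points of an embedding form a
  field.\<close>

lemma subfield_hom_equalizer_subfield:
  assumes E: "subfield E R" and h: "h \<in> ring_hom (R\<lparr>carrier := E\<rparr>) R"
    and g: "g \<in> ring_hom (R\<lparr>carrier := E\<rparr>) R"
  shows "subfield {x \<in> E. h x = g x} R" (is "subfield ?Q R")
proof (rule subfieldI'[OF subringI])
  note sE = subringE[OF subfieldE(1)[OF E]]
  show "?Q \<subseteq> carrier R" using sE(1) by auto
  show "\<one> \<in> ?Q" using sE(3) subfield_hom_one[OF E h] subfield_hom_one[OF E g] by simp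
  fix x assume x: "x \<in> ?Q"
  show "\<ominus> x \<in> ?Q"
    using x sE(5) subfield_hom_uminus[OF E h] subfield_hom_uminus[OF E g] by simp
  fix y assume y: "y \<in> ?Q"
  show "x \<otimes> y \<in> ?Q"
    using x y sE(6) subfield_hom_mult[OF E h] subfield_hom_mult[OF E g] by simp
  show "x \<oplus> y \<in> ?Q"
    using x y sE(7) subfield_hom_add[OF E h] subfield_hom_add[OF E g] by simp
next
  fix x assume x: "x \<in> ?Q - {\<zero>}"
  then have xi: "inv x \<in> E" "inv x \<otimes> x = \<one>"
    using subfield_m_inv[OF E, of x] by auto
  have "h (inv x) \<otimes> h x = \<one>" "g (inv x) \<otimes> h x = \<one>"
    using x xi subfield_hom_mult[OF E h, of "inv x" x] subfield_hom_mult[OF E g, of "inv x" x]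
      subfield_hom_one[OF E h] subfield_hom_one[OF E g] by auto
  then have "h (inv x) = g (inv x)"
    using x xi subfield_hom_closed[OF E h] subfield_hom_closed[OF E g]
    by (metis (no_types, lifting) DiffD1 inv_unique m_comm mem_Collect_eq)
  then show "inv x \<in> ?Q" using xi by simp
qed

lemma subfield_hom_ext_finite_extension:
  assumes E: "subfield E R" "E = finite_extension K xs"
    and h: "h \<in> ring_hom (R\<lparr>carrier := E\<rparr>) R" and g: "g \<in> ring_hom (R\<lparr>carrier := E\<rparr>) R"
    and K: "K \<subseteq> E" "\<And>x. x \<in> K \<Longrightarrow> h x = g x"
    and xs: "set xs \<subseteq> E" "\<And>x. x \<in> set xs \<Longrightarrow> h x = g x"
    and x: "x \<in> E"
  shows "h x = g x"
proof -
  have "finite_extension K xs \<subseteq> {x \<in> E. h x = g x}"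
    using K xs
    by (intro finite_extension_subring_incl
          subfieldE(1)[OF subfield_hom_equalizer_subfield[OF E(1) h g]]) auto
  then show ?thesis using x E(2) by auto
qed

section \<open>Extension of a homomorphism to a simple extension\<close>

lemma subfield_hom_eval_map:
  assumes K: "subfield K R" and h: "h \<in> ring_hom (R\<lparr>carrier := K\<rparr>) R" and b: "b \<in> carrier R"
    and p: "p \<in> carrier (K[X])" and q: "q \<in> carrier (K[X])"
  shows "eval (map h (p \<oplus>\<^bsub>K[X]\<^esub> q)) b = eval (map h p) b \<oplus> eval (map h q) b"
    and "eval (map h (p \<otimes>\<^bsub>K[X]\<^esub> q)) b = eval (map h p) b \<otimes> eval (map h q) b"
proof -
  interpret H: ring_hom_ring "R\<lparr>carrier := K\<rparr>" R h
    by (rule subfield_hom_ring[OF K h])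
  note sK = subfieldE(1)[OF K]
  have sp: "set p \<subseteq> K" and sq: "set q \<subseteq> K"
    using p q polynomial_incl unfolding univ_poly_carrier[symmetric] by auto
  then have hp: "set (map h p) \<subseteq> carrier R" and hq: "set (map h q) \<subseteq> carrier R"
    using subfield_hom_closed[OF K h] by auto
  have "set (poly_add p q) \<subseteq> K" "set (poly_mult p q) \<subseteq> K"
    using polynomial_incl[OF poly_add_is_polynomial[OF sK sp sq]]
      polynomial_incl[OF poly_mult_is_polynomial[OF sK sp sq]] .
  then have cadd: "set (map h (poly_add p q)) \<subseteq> carrier R" and
      cmul: "set (map h (poly_mult p q)) \<subseteq> carrier R"
    using subfield_hom_closed[OF K h] by auto
  \<comment> \<open>\<open>poly_add_hom'\<close> compares the two polynomials after
    \<open>normalize\<close>, a difference that evaluation does not see.\<close>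
  have "eval (map h (poly_add p q)) b = eval (normalize (map h (poly_add p q))) b"
    using eval_normalize[OF cadd b] by simp
  also have "\<dots> = eval (poly_add (map h p) (map h q)) b"
    using H.poly_add_hom'[of p q] sp sq poly_add_consistent[OF sK] by simp
  also have "\<dots> = eval (map h p) b \<oplus> eval (map h q) b"
    by (rule eval_poly_add[OF hp hq b])
  finally show "eval (map h (p \<oplus>\<^bsub>K[X]\<^esub> q)) b = eval (map h p) b \<oplus> eval (map h q) b"
    by (simp add: univ_poly_add)
  have "eval (map h (poly_mult p q)) b = eval (normalize (map h (poly_mult p q))) b"
    using eval_normalize[OF cmul b] by simp
  also have "\<dots> = eval (poly_mult (map h p) (map h q)) b"
    using H.poly_mult_hom'[of p q] sp sq poly_mult_consistent[OF sK] by simp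
  also have "\<dots> = eval (map h p) b \<otimes> eval (map h q) b"
    by (rule eval_poly_mult[OF hp hq b])
  finally show "eval (map h (p \<otimes>\<^bsub>K[X]\<^esub> q)) b = eval (map h p) b \<otimes> eval (map h q) b"
    by (simp add: univ_poly_mult)
qed

lemma Irr_divides:
  assumes "subfield K R" "x \<in> carrier R" "(algebraic over K) x"
    and "p \<in> carrier (K[X])" "eval p x = \<zero>"
  obtains q where "q \<in> carrier (K[X])" "p = Irr K x \<otimes>\<^bsub>K[X]\<^esub> q"
  using Irr_minimal[OF assms] pdivides_iff_shell[OF assms(1) IrrE(1)[OF assms(1-3)] assms(4)]
  unfolding factor_def by blast

text \<open>K(x) is K[X] modulo the minimal polynomial of \<open>x\<close>. Sending p(x) to the
  value at \<open>b\<close> of the transported polynomial is well defined, because two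
  representatives differ by a multiple of \<open>Irr K x\<close>, whose transport vanishes at
  \<open>b\<close>.\<close>

lemma extend_hom_simple_extension:
  assumes K: "subfield K R" and h: "h \<in> ring_hom (R\<lparr>carrier := K\<rparr>) R"
    and x: "x \<in> carrier R" "(algebraic over K) x"
    and b: "b \<in> carrier R" "eval (map h (Irr K x)) b = \<zero>"
  obtains g where "g \<in> ring_hom (R\<lparr>carrier := simple_extension K x\<rparr>) R"
    "\<And>k. k \<in> K \<Longrightarrow> g k = h k" "g x = b"
proof -
  let ?E = "simple_extension K x"
  let ?\<Phi> = "\<lambda>p. eval (map h p) b"
  note sK = subfieldE(1)[OF K]
  interpret UP: domain "K[X]" by (rule univ_poly_is_domain[OF sK])
  interpret ev: ring_hom_ring "K[X]" R "\<lambda>p. eval p x" by (rule eval_ring_hom[OF sK x(1)])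
  have cl: "?\<Phi> p \<in> carrier R" if "p \<in> carrier (K[X])" for p
    using subfield_hom_map_polynomial[OF K h that] b(1) eval_in_carrier polynomial_incl
    unfolding univ_poly_carrier[symmetric] by blast
  note hadd = subfield_hom_eval_map(1)[OF K h b(1)]
    and hmult = subfield_hom_eval_map(2)[OF K h b(1)]
  have wd: "?\<Phi> p = ?\<Phi> q"
    if p: "p \<in> carrier (K[X])" and q: "q \<in> carrier (K[X])" and e: "eval p x = eval q x" for p q
  proof -
    let ?d = "p \<ominus>\<^bsub>K[X]\<^esub> q"
    have d: "?d \<in> carrier (K[X])" using p q by simp
    have "eval ?d x = eval p x \<ominus> eval q x"
      using p q by (simp add: a_minus_def)
    then have "eval ?d x = \<zero>"
      using e p q ev.hom_closed by (simp add: a_minus_def r_neg)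
    then obtain r where r: "r \<in> carrier (K[X])" "?d = Irr K x \<otimes>\<^bsub>K[X]\<^esub> r"
      using Irr_divides[OF K x d] by blast
    have "?\<Phi> ?d = \<zero>"
      unfolding r(2) using hmult[OF IrrE(1)[OF K x] r(1)] b(2) cl[OF r(1)] by simp
    moreover have "p = ?d \<oplus>\<^bsub>K[X]\<^esub> q"
      using p q by (simp add: a_minus_def UP.a_assoc UP.l_neg)
    ultimately show ?thesis
      using hadd[OF d q] cl[OF q] by simp
  qed
  define g where "g y = ?\<Phi> (SOME p. p \<in> carrier (K[X]) \<and> eval p x = y)" for y
  have g: "g (eval p x) = ?\<Phi> p" if "p \<in> carrier (K[X])" for p
  proof -
    let ?P = "\<lambda>q. q \<in> carrier (K[X]) \<and> eval q x = eval p x"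
    have "?P (SOME q. ?P q)" by (rule someI[of ?P p]) (simp add: that)
    then show ?thesis unfolding g_def using wd that by blast
  qed
  have E: "\<exists>p \<in> carrier (K[X]). y = eval p x" if "y \<in> ?E" for y
    using that simple_extension_as_eval_img[OF subfieldE(3)[OF K] x(1)] by auto
  \<comment> \<open>A nonzero constant is the polynomial \<open>[k]\<close>, but the constant zero
    is the empty list, hence the case distinction.\<close>
  have const: "g k = h k" if "k \<in> K" for k
  proof (cases "k = \<zero>")
    case True
    have "[] \<in> carrier (K[X])" by (rule univ_poly_zero_closed)
    then have "g \<zero> = \<zero>" using g[of "[]"] by simp
    then show ?thesis using True subfield_hom_zero[OF K h] by simp
  next
    case False
    then have "[k] \<in> carrier (K[X])"
      using that unfolding univ_poly_carrier[symmetric] polynomial_def by simp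
    then show ?thesis
      using g[of "[k]"] that subfieldE(3)[OF K] subfield_hom_closed[OF K h] by auto
  qed
  show thesis
  proof
    show "g \<in> ring_hom (R\<lparr>carrier := ?E\<rparr>) R"
    proof (rule ring_hom_memI, simp_all)
      fix y assume "y \<in> ?E"
      then show "g y \<in> carrier R" using E g cl by fastforce
    next
      fix y z assume yz: "y \<in> ?E" "z \<in> ?E"
      then obtain p q where "p \<in> carrier (K[X])" "y = eval p x" "q \<in> carrier (K[X])" "z = eval q x"
        using E by blast
      then show "g (y \<otimes> z) = g y \<otimes> g z" "g (y \<oplus> z) = g y \<oplus> g z"
        using g[of "p \<otimes>\<^bsub>K[X]\<^esub> q"] g[of "p \<oplus>\<^bsub>K[X]\<^esub> q"] g[of p] g[of q] hmult hadd
        by simp_all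
    next
      show "g \<one> = \<one>"
        using const[OF subringE(3)[OF sK]] subfield_hom_one[OF K h] by simp
    qed
    show "g k = h k" if "k \<in> K" for k by (rule const[OF that])
    have "X \<in> carrier (K[X])" by (rule var_closed(1)[OF sK])
    moreover have "map h X = X"
      using subfield_hom_one[OF K h] subfield_hom_zero[OF K h] by (simp add: var_def)
    ultimately show "g x = b"
      using g[of X] eval_var[OF x(1)] eval_var[OF b(1)] by simp
  qed
qed

text \<open>An irreducible polynomial is, up to normalization, the minimal polynomial of each of its
  roots. Conjugates therefore inherit algebraicity and separability.\<close>

lemma Irr_eqI:
  assumes K: "subfield K R" and x: "x \<in> carrier R" "(algebraic over K) x"
    and b: "b \<in> carrier R" "eval (Irr K x) b = \<zero>"
  shows "(algebraic over K) b" "Irr K b = Irr K x"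
proof -
  show *: "(algebraic over K) b"
    using algebraicI[OF IrrE(1)[OF K x] _ b(2)]
      pirreducibleE(1)[OF subfieldE(1)[OF K] IrrE(1,2)[OF K x]] by blast
  have "\<exists>!p. p \<in> carrier (K[X]) \<and> pirreducible K p \<and> eval p b = \<zero> \<and> lead_coeff p = \<one>"
    using minimal_polynomial_is_unique[OF K b(1) *] .
  then show "Irr K b = Irr K x"
    using IrrE[OF K x] IrrE[OF K b(1) *] b(2) by blast
qed

section \<open>Generators, towers and degrees of finite extensions\<close>

lemma finite_field_ext_generators:
  assumes "finite_field_ext R K E"
  obtains xs where "set xs \<subseteq> E" "E = finite_extension K xs"
proof -
  have K: "subfield K R" and E: "subfield E R" and KE: "K \<subseteq> E" and fin: "finite_dimension K E"
    using assms unfolding finite_field_ext_def by auto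
  obtain n where "dimension n K E" using fin by auto
  \<comment> \<open>A vector space basis of \<open>E\<close> over \<open>K\<close> is reused as a
    list of field generators, which makes finite extensions accessible to induction on
    lists.\<close>
  then obtain xs where xs: "set xs \<subseteq> carrier R" "Span K xs = E"
    using exists_base[OF K] by blast
  have xsE: "set xs \<subseteq> E" using Span_base_incl[OF K xs(1)] xs(2) by simp
  have 1: "finite_extension K xs \<subseteq> E"
    by (rule finite_extension_subring_incl[OF subfieldE(1)[OF E] KE xsE])
  have alg: "(algebraic over K) x" if "x \<in> set xs" for x
    using finite_dimension_imp_algebraic[OF K subfieldE(1)[OF E] fin] that xsE by auto
  have "subalgebra K (finite_extension K xs) R"
    by (rule finite_dimension_imp_subalgebra[OF K finite_extension_finite_dimension(1)[OF K xs(1) alg]])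
  then have "Span K xs \<subseteq> finite_extension K xs"
    using subalgebra_Span_incl[OF K] finite_extension_mem[OF subfieldE(1)[OF K] xs(1)] by blast
  with 1 xs(2) xsE show thesis by (intro that) auto
qed

lemma finite_field_extD:
  assumes "finite_field_ext R K E"
  shows "subfield K R" "subfield E R" "K \<subseteq> E" "finite_dimension K E"
    "E \<subseteq> carrier R" "K \<subseteq> carrier R"
    "\<And>x. x \<in> E \<Longrightarrow> (algebraic over K) x" "\<And>x. x \<in> E \<Longrightarrow> x \<in> carrier R"
  using assms subfieldE(1,3) finite_dimension_imp_algebraic unfolding finite_field_ext_def by blast+

lemma finite_field_ext_finite_extension:
  assumes K: "subfield K R" and xs: "set xs \<subseteq> carrier R" "\<And>x. x \<in> set xs \<Longrightarrow> (algebraic over K) x"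
  shows "finite_field_ext R K (finite_extension K xs)"
  unfolding finite_field_ext_def
  using K finite_extension_is_subfield[OF K xs] finite_extension_incl[OF subfieldE(3)[OF K] xs(1)]
    finite_extension_finite_dimension(1)[OF K xs] by blast

text \<open>Generators of \<open>E\<close> over \<open>K\<close> still generate it over
  \<open>M\<close>, and they stay algebraic there.\<close>

lemma finite_field_ext_upper:
  assumes "finite_field_ext R K E" "subfield M R" "K \<subseteq> M" "M \<subseteq> E"
  shows "finite_field_ext R M E"
proof -
  obtain xs where xs: "set xs \<subseteq> E" "E = finite_extension K xs"
    using finite_field_ext_generators[OF assms(1)] .
  note KE = finite_field_extD[OF assms(1)]
  have sub: "set xs \<subseteq> carrier R" using xs(1) KE(5) by blast
  have alg: "(algebraic over M) x" if "x \<in> set xs" for x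
    using algebraic_mono[OF assms(3)] KE(7) that xs(1) by blast
  have "finite_extension M xs = E"
  proof
    show "finite_extension M xs \<subseteq> E"
      by (rule finite_extension_subring_incl[OF subfieldE(1)[OF KE(2)] assms(4) xs(1)])
    show "E \<subseteq> finite_extension M xs"
      using mono_finite_extension[OF assms(3), of xs] xs(2) by simp
  qed
  then show ?thesis using finite_field_ext_finite_extension[OF assms(2) sub alg] by simp
qed

lemma finite_field_ext_lower:
  assumes "finite_field_ext R K E" "subfield M R" "K \<subseteq> M" "M \<subseteq> E"
  shows "finite_field_ext R K M"
proof -
  note KE = finite_field_extD[OF assms(1)]
  have "subalgebra K M R"
  proof (intro subalgebra.intro subalgebra_axioms.intro)
    show "subgroup M (add_monoid R)"
      using subfieldE(1)[OF assms(2)] subring_def by blast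
    show "k \<otimes> v \<in> M" if "k \<in> K" "v \<in> M" for k v
      using that assms(3) subringE(6)[OF subfieldE(1)[OF assms(2)]] by blast
  qed
  then show ?thesis
    unfolding finite_field_ext_def
    using assms KE subalbegra_incl_imp_finite_dimension[OF KE(1,4)] by blast
qed

lemma finite_field_ext_trans:
  assumes "finite_field_ext R K M" "finite_field_ext R M E"
  shows "finite_field_ext R K E" "dim K E = dim K M * dim M E"
  using telescopic_base_dim[of K M E] assms unfolding finite_field_ext_def over_def by auto

lemma finite_field_ext_refl:
  assumes "subfield K R"
  shows "finite_field_ext R K K" "dim K K = 1"
  using assms finite_dimensionI[OF dimension_one] dimI[OF assms dimension_one[OF assms]]
  unfolding finite_field_ext_def over_def by auto

lemma finite_field_ext_dim_pos:
  assumes "finite_field_ext R K E"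
  shows "dim K E > 0"
proof (rule ccontr)
  note KE = finite_field_extD[OF assms]
  assume "\<not> dim K E > 0"
  then have "dimension 0 K E"
    using finite_dimensionE[OF KE(1,4)] unfolding over_def by simp
  then have "E = {\<zero>}" by (rule dimension_zero[OF KE(1)])
  then show False
    using subringE(3)[OF subfieldE(1)[OF KE(2)]] by simp
qed

lemma finite_field_ext_dim_1:
  assumes "finite_field_ext R K E" "dim K E = 1"
  shows "E = K"
proof -
  note KE = finite_field_extD[OF assms(1)]
  have d: "dimension 1 K E"
    using finite_dimensionE[OF KE(1,4)] assms(2) unfolding over_def by simp
  have "dimension 1 K K" by (rule dimension_one[OF KE(1)])
  then obtain Us where Us: "independent K Us" "length Us = 1" "Span K Us = K"
    using exists_base[OF KE(1)] by blast
  have "set Us \<subseteq> E"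
    using Span_base_incl[OF KE(1) independent_in_carrier[OF Us(1)]] Us(3) KE(3) by simp
  then show ?thesis
    using independent_length_eq_dimension[OF KE(1) d Us(1)] Us by simp
qed

end

section \<open>Counting embeddings\<close>

context field
begin

section \<open>Finiteness, composition and inversion of embeddings\<close>

lemma embeddings_antimono: "K \<subseteq> M \<Longrightarrow> embeddings R M E \<subseteq> embeddings R K E"
  by (auto simp: embeddings_def)

lemma embeddings_root:
  assumes E: "subfield E R" and \<phi>: "\<phi> \<in> embeddings R K E" and K: "K \<subseteq> E"
    and p: "p \<in> carrier (K[X])" and x: "x \<in> E" "eval p x = \<zero>"
  shows "eval p (\<phi> x) = \<zero>"
proof -
  have sp: "set p \<subseteq> K"
    using p polynomial_incl unfolding univ_poly_carrier[symmetric] by auto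
  then have "map \<phi> p = p"
    using embeddingsD(3)[OF \<phi>] by (intro map_idI) auto
  then show ?thesis
    using subfield_hom_eval[OF E embeddingsD(1)[OF \<phi>], of p x] sp K x
      subfield_hom_zero[OF E embeddingsD(1)[OF \<phi>]] by auto
qed

lemma embeddings_Irr_root:
  assumes "finite_field_ext R K E" and "\<phi> \<in> embeddings R K E" "x \<in> E"
  shows "eval (Irr K x) (\<phi> x) = \<zero>" "\<phi> x \<in> carrier R"
  using embeddings_root[OF _ assms(2) _ IrrE(1)[of K x] assms(3) IrrE(4)[of K x]]
    finite_field_extD[OF assms(1)] assms(3) subfield_hom_closed[OF _ embeddingsD(1)[OF assms(2)]]
  by auto

lemma finite_roots_Irr:
  assumes "subfield K R" "x \<in> carrier R" "(algebraic over K) x"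
  shows "finite {b \<in> carrier R. eval (Irr K x) b = \<zero>}"
proof -
  have "finite {b. is_root (Irr K x) b}"
    by (rule finite_number_of_roots[OF carrier_polynomial_shell[OF subfieldE(1)[OF assms(1)] IrrE(1)[OF assms]]])
  moreover have "{b \<in> carrier R. eval (Irr K x) b = \<zero>} = {b. is_root (Irr K x) b}"
    using pirreducibleE(1)[OF subfieldE(1)[OF assms(1)] IrrE(1,2)[OF assms]]
    by (auto simp: is_root_def)
  ultimately show ?thesis by simp
qed

lemma embeddings_eqI:
  assumes "\<phi> \<in> embeddings R K E" "\<psi> \<in> embeddings R K E" "\<And>x. x \<in> E \<Longrightarrow> \<phi> x = \<psi> x"
  shows "\<phi> = \<psi>"
  using assms extensionalityI[of \<phi> E \<psi>] embeddingsD(2) by blast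

text \<open>An embedding is determined by its values on finitely many generators, and each value is
  one of the finitely many roots of a minimal polynomial.\<close>

lemma finite_embeddings:
  assumes "finite_field_ext R K E"
  shows "finite (embeddings R K E)"
proof -
  note KE = finite_field_extD[OF assms]
  obtain xs where xs: "set xs \<subseteq> E" "E = finite_extension K xs"
    using finite_field_ext_generators[OF assms] .
  let ?roots = "\<lambda>x. {b \<in> carrier R. eval (Irr K x) b = \<zero>}"
  have "(\<lambda>\<phi>. restrict \<phi> (set xs)) ` embeddings R K E \<subseteq> Pi\<^sub>E (set xs) ?roots"
    using embeddings_Irr_root[OF assms] xs(1) by (auto simp: PiE_def Pi_def)
  moreover have "finite (Pi\<^sub>E (set xs) ?roots)"
    using finite_roots_Irr KE(1,7,8) xs(1) by (intro finite_PiE) auto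
  moreover have "inj_on (\<lambda>\<phi>. restrict \<phi> (set xs)) (embeddings R K E)"
  proof (rule inj_onI)
    fix \<phi> \<psi> assume \<phi>: "\<phi> \<in> embeddings R K E" and \<psi>: "\<psi> \<in> embeddings R K E"
      and eq: "restrict \<phi> (set xs) = restrict \<psi> (set xs)"
    have 1: "\<phi> x = \<psi> x" if "x \<in> set xs" for x
      using fun_cong[OF eq, of x] that by simp
    have 2: "\<phi> x = \<psi> x" if "x \<in> K" for x
      using embeddingsD(3)[OF \<phi> that] embeddingsD(3)[OF \<psi> that] by simp
    show "\<phi> = \<psi>"
      by (rule embeddings_eqI[OF \<phi> \<psi>])
        (rule subfield_hom_ext_finite_extension[OF KE(2) xs(2) embeddingsD(1)[OF \<phi>]
            embeddingsD(1)[OF \<psi>] KE(3) 2 xs(1) 1])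
  qed
  ultimately show ?thesis
    by (meson finite_imageD finite_subset)
qed

text \<open>An injective self-map permutes the finite set of conjugates of each element, hence is onto.\<close>

lemma embedding_image_eq:
  assumes "finite_field_ext R K E" and \<phi>: "\<phi> \<in> embeddings R K E" and sub: "\<phi> ` E \<subseteq> E"
  shows "\<phi> ` E = E"
proof
  note KE = finite_field_extD[OF assms(1)]
  show "E \<subseteq> \<phi> ` E"
  proof
    fix x assume x: "x \<in> E"
    let ?S = "{b \<in> E. eval (Irr K x) b = \<zero>}"
    note Kx = KE(1) KE(8)[OF x] KE(7)[OF x]
    have "finite ?S"
      by (rule finite_subset[OF _ finite_roots_Irr[OF Kx]]) (use KE(5) in auto)
    moreover have "\<phi> ` ?S \<subseteq> ?S"
      using embeddings_root[OF KE(2) \<phi> KE(3) IrrE(1)[OF Kx]] sub by auto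
    moreover have "inj_on \<phi> ?S"
      by (rule inj_on_subset[OF subfield_hom_inj[OF KE(2) embeddingsD(1)[OF \<phi>]]]) auto
    ultimately have "\<phi> ` ?S = ?S" by (simp add: endo_inj_surj)
    then show "x \<in> \<phi> ` E" using x IrrE(4)[OF Kx] by blast
  qed
qed (rule sub)

lemma identity_embedding:
  assumes "subfield E R" "K \<subseteq> E"
  shows "(\<lambda>x\<in>E. x) \<in> embeddings R K E"
proof -
  have "(\<lambda>x\<in>E. x) \<in> ring_hom (R\<lparr>carrier := E\<rparr>) R"
    by (rule ring_hom_memI)
      (use subfieldE(3)[OF assms(1)] subringE[OF subfieldE(1)[OF assms(1)]] in auto)
  then show ?thesis using assms(2) unfolding embeddings_def by auto
qed

lemma compose_embeddings:
  assumes F: "subfield F R" and E: "subfield E R" and \<phi>: "\<phi> \<in> embeddings R K F"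
    and \<psi>: "\<psi> \<in> embeddings R K E" and im: "\<psi> ` E \<subseteq> F" and K: "K \<subseteq> E"
  shows "compose E \<phi> \<psi> \<in> embeddings R K E"
proof -
  note a = embeddingsD[OF \<phi>] and b = embeddingsD[OF \<psi>]
  note sE = subringE[OF subfieldE(1)[OF E]]
  have im': "x \<in> E \<Longrightarrow> \<psi> x \<in> F" for x using im by auto
  have "compose E \<phi> \<psi> \<in> ring_hom (R\<lparr>carrier := E\<rparr>) R"
    by (rule ring_hom_memI)
      (simp_all add: compose_eq im' sE subfield_hom_closed[OF F a(1)]
        subfield_hom_mult[OF F a(1)] subfield_hom_add[OF F a(1)] subfield_hom_one[OF F a(1)]
        subfield_hom_mult[OF E b(1)] subfield_hom_add[OF E b(1)] subfield_hom_one[OF E b(1)])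
  then show ?thesis
    using a(3) b(3) K unfolding embeddings_def by (auto simp: compose_eq)
qed

lemma restrict_embeddings:
  assumes "subfield M R" "subfield E R" "M \<subseteq> E" "\<phi> \<in> embeddings R K E" "K \<subseteq> M"
  shows "restrict \<phi> M \<in> embeddings R K M"
proof -
  note sM = subringE[OF subfieldE(1)[OF assms(1)]]
  note a = assms(2) embeddingsD(1)[OF assms(4)]
  have ME: "x \<in> M \<Longrightarrow> x \<in> E" for x using assms(3) by auto
  have "restrict \<phi> M \<in> ring_hom (R\<lparr>carrier := M\<rparr>) R"
    by (rule ring_hom_memI)
      (simp_all add: ME sM subfield_hom_closed[OF a] subfield_hom_mult[OF a]
        subfield_hom_add[OF a] subfield_hom_one[OF a])
  then show ?thesis
    using assms embeddingsD(3)[OF assms(4)] unfolding embeddings_def by auto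
qed

lemma inv_embeddings:
  assumes E: "subfield E R" and \<phi>: "\<phi> \<in> embeddings R K E" and K: "K \<subseteq> E"
  shows "restrict (inv_into E \<phi>) (\<phi> ` E) \<in> embeddings R K (\<phi> ` E)"
    and "restrict (inv_into E \<phi>) (\<phi> ` E) ` \<phi> ` E = E"
proof -
  note a = embeddingsD[OF \<phi>]
  have inj: "inj_on \<phi> E" by (rule subfield_hom_inj[OF E a(1)])
  interpret H: ring_hom_ring "R\<lparr>carrier := E\<rparr>" R \<phi>
    by (rule subfield_hom_ring[OF E a(1)])
  let ?g = "inv_into E \<phi>"
  have "ring_hom_ring (R\<lparr>carrier := \<phi> ` E\<rparr>) (R\<lparr>carrier := E\<rparr>) ?g"
    using H.inv_ring_hom[OF _ H.R.carrier_is_subring] inj by simp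
  then have g: "?g \<in> ring_hom (R\<lparr>carrier := \<phi> ` E\<rparr>) (R\<lparr>carrier := E\<rparr>)"
    by (rule ring_hom_ring.homh)
  have sI: "subring (\<phi> ` E) R"
    by (rule subfieldE(1)[OF subfield_hom_image[OF E a(1)]])
  have "restrict ?g (\<phi> ` E) \<in> ring_hom (R\<lparr>carrier := \<phi> ` E\<rparr>) R"
    by (rule ring_hom_memI)
      (simp_all add: ring_hom_memE[OF g, simplified] subringE[OF sI] inv_into_into
        subsetD[OF subfieldE(3)[OF E]])
  moreover have "restrict ?g (\<phi> ` E) x = x" if "x \<in> K" for x
    using inv_into_f_f[OF inj, of x] a(3)[OF that] that K by force
  ultimately show "restrict ?g (\<phi> ` E) \<in> embeddings R K (\<phi> ` E)"
    unfolding embeddings_def by auto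
  show "restrict ?g (\<phi> ` E) ` \<phi> ` E = E"
    using inj by (auto simp: image_iff)
qed

end

section \<open>Extension of embeddings and multiplicativity in towers\<close>

context algebraically_closed
begin

lemma exists_root:
  assumes "p \<in> carrier (poly_ring L)" "degree p \<ge> 1"
  obtains b where "b \<in> carrier L" "eval p b = \<zero>"
proof -
  have "size (roots p) = degree p"
    using roots_over_carrier[OF assms(1)] by (simp add: splitted_def)
  then have "roots p \<noteq> {#}" using assms(2) by auto
  then obtain b where "b \<in># roots p" by blast
  then show thesis
    using that roots_mem_iff_is_root[OF assms(1)] by (auto simp: is_root_def)
qed

text \<open>One generator at a time: over the field reached so far, the transported minimal
  polynomial of the next generator has a root in the closure, and the generator is sent there. The
  map \<open>h\<close> may move \<open>K\<close>, since the base will be an intermediate field on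
  which an embedding is already given.\<close>

lemma extend_hom_finite_extension:
  assumes K: "subfield K L" and h: "h \<in> ring_hom (L\<lparr>carrier := K\<rparr>) L"
    and xs: "set xs \<subseteq> carrier L" "\<And>x. x \<in> set xs \<Longrightarrow> (algebraic over K) x"
  shows "\<exists>g \<in> ring_hom (L\<lparr>carrier := finite_extension K xs\<rparr>) L. \<forall>k\<in>K. g k = h k"
  using xs
proof (induction xs)
  case Nil
  then show ?case using h by auto
next
  case (Cons x xs)
  let ?M = "finite_extension K xs"
  obtain g where g: "g \<in> ring_hom (L\<lparr>carrier := ?M\<rparr>) L" "\<And>k. k \<in> K \<Longrightarrow> g k = h k"
    using Cons by auto
  have M: "subfield ?M L" "K \<subseteq> ?M"
    using finite_field_extD(2,3)[OF finite_field_ext_finite_extension[OF K, of xs]] Cons(2,3) by auto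
  have x: "x \<in> carrier L" "(algebraic over ?M) x"
    using Cons(2,3) algebraic_mono[OF M(2)] by auto
  note irr = IrrE[OF M(1) x]
  have "degree (map g (Irr ?M x)) \<ge> 1"
    using pirreducible_degree[OF M(1) irr(1,2)] by simp
  then obtain b where b: "b \<in> carrier L" "eval (map g (Irr ?M x)) b = \<zero>"
    using exists_root[OF subfield_hom_map_polynomial[OF M(1) g(1) irr(1)]] by blast
  obtain g' where g': "g' \<in> ring_hom (L\<lparr>carrier := simple_extension ?M x\<rparr>) L"
      "\<And>k. k \<in> ?M \<Longrightarrow> g' k = g k"
    using extend_hom_simple_extension[OF M(1) g(1) x b] by blast
  then have "\<forall>k\<in>K. g' k = h k" using g(2) M(2) by auto
  then show ?case using g'(1) by auto
qed

lemma extend_embedding: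
  assumes KE: "finite_field_ext L K E" and M: "subfield M L" "K \<subseteq> M" "M \<subseteq> E"
    and \<phi>: "\<phi> \<in> embeddings L K M"
  obtains \<psi> where "\<psi> \<in> embeddings L K E" "restrict \<psi> M = \<phi>"
proof -
  note ME = finite_field_ext_upper[OF KE M]
  obtain xs where xs: "set xs \<subseteq> E" "E = finite_extension M xs"
    using finite_field_ext_generators[OF ME] .
  obtain g where g: "g \<in> ring_hom (L\<lparr>carrier := E\<rparr>) L" "\<forall>k\<in>M. g k = \<phi> k"
    using extend_hom_finite_extension[OF M(1) embeddingsD(1)[OF \<phi>], of xs] xs
      finite_field_extD(7,8)[OF ME] by blast
  have "restrict g E \<in> ring_hom (L\<lparr>carrier := E\<rparr>) L"
    by (rule ring_hom_memI)
      (use ring_hom_memE[OF g(1)] subringE[OF subfieldE(1)[OF finite_field_extD(2)[OF KE]]] in auto)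
  then have "restrict g E \<in> embeddings L K E"
    using embeddingsD(3)[OF \<phi>] g(2) M unfolding embeddings_def by auto
  moreover have "restrict (restrict g E) M = \<phi>"
    using embeddingsD(2)[OF \<phi>] g(2) M(3) by (intro extensionalityI[of _ M]) auto
  ultimately show thesis by (rule that)
qed

text \<open>\<open>N\<close> is generated by all conjugates of the generators of \<open>E\<close>.
  An embedding sends a conjugate to a conjugate, so it maps the generators of \<open>N\<close> into
  \<open>N\<close>, and then maps \<open>N\<close> onto itself.\<close>

lemma finite_normal_closure:
  assumes KE: "finite_field_ext L K E"
  obtains N where "finite_field_ext L K N" "E \<subseteq> N"
    "\<And>\<phi>. \<phi> \<in> embeddings L K N \<Longrightarrow> \<phi> ` N = N"
proof -
  note K = finite_field_extD[OF KE]
  obtain xs where xs: "set xs \<subseteq> E" "E = finite_extension K xs"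
    using finite_field_ext_generators[OF KE] .
  define S where "S = (\<Union>x\<in>set xs. {b \<in> carrier L. eval (Irr K x) b = \<zero>})"
  have "finite S"
    unfolding S_def using finite_roots_Irr K(1,7,8) xs(1) by blast
  then obtain ys where ys: "set ys = S" using finite_list by blast
  have sub: "set ys \<subseteq> carrier L" unfolding ys S_def by auto
  have alg: "(algebraic over K) y" if "y \<in> set ys" for y
    using that Irr_eqI(1)[OF K(1)] K(7,8) xs(1) unfolding ys S_def by blast
  let ?N = "finite_extension K ys"
  note KN = finite_field_ext_finite_extension[OF K(1) sub alg]
  note N = finite_field_extD[OF KN]
  have ysN: "set ys \<subseteq> ?N" by (rule finite_extension_mem[OF subfieldE(1)[OF K(1)] sub])
  have "set xs \<subseteq> S"
    unfolding S_def using IrrE(4)[OF K(1)] K(7,8) xs(1) by blast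
  then have EN: "E \<subseteq> ?N"
    unfolding xs(2) using ysN ys N(2,3)
    by (intro finite_extension_subring_incl subfieldE(1)) auto
  have "\<phi> ` ?N = ?N" if \<phi>: "\<phi> \<in> embeddings L K ?N" for \<phi>
  proof (rule embedding_image_eq[OF KN \<phi>])
    have "\<phi> y \<in> ?N" if y: "y \<in> set ys" for y
    proof -
      obtain x where x: "x \<in> set xs" "eval (Irr K x) y = \<zero>"
        using y ys S_def by auto
      have "eval (Irr K x) (\<phi> y) = \<zero>"
        using embeddings_root[OF N(2) \<phi> N(3) IrrE(1)[OF K(1)] _ x(2)] x(1) xs(1) K(7,8) y ysN
        by blast
      moreover have "\<phi> y \<in> carrier L"
        using subfield_hom_closed[OF N(2) embeddingsD(1)[OF \<phi>]] y ysN by blast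
      ultimately have "\<phi> y \<in> S" unfolding S_def using x(1) by blast
      then show ?thesis using ys ysN by blast
    qed
    then have "?N \<subseteq> {x \<in> ?N. \<phi> x \<in> ?N}"
      using embeddingsD(3)[OF \<phi>] N(3) ysN
      by (intro finite_extension_subring_incl
          subfield_hom_preimage_subring[OF N(2) embeddingsD(1)[OF \<phi>] subfieldE(1)[OF N(2)]]) auto
    then show "\<phi> ` ?N \<subseteq> ?N" by blast
  qed
  with KN EN show thesis by (rule that)
qed

text \<open>Fix one extension \<open>g\<close> of \<open>\<phi>\<close>. Composition with
  \<open>g\<close> carries \<open>embeddings L M N\<close> onto the fibre over
  \<open>\<phi>\<close>, and composition with the inverse of \<open>g\<close> leads back; stability
  of \<open>N\<close> is what makes \<open>g\<close> invertible on \<open>N\<close>.\<close>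

lemma card_embeddings_mult_stable:
  assumes KN: "finite_field_ext L K N" and M: "subfield M L" "K \<subseteq> M" "M \<subseteq> N"
    and N: "\<And>\<phi>. \<phi> \<in> embeddings L K N \<Longrightarrow> \<phi> ` N = N"
  shows "card (embeddings L K M) * card (embeddings L M N) = card (embeddings L K N)"
proof -
  note K = finite_field_extD[OF KN]
  have MN: "embeddings L M N \<subseteq> embeddings L K N" by (rule embeddings_antimono[OF M(2)])
  let ?fib = "\<lambda>\<phi>. {\<psi> \<in> embeddings L K N. restrict \<psi> M = \<phi>}"
  have fin: "finite (embeddings L K N)" by (rule finite_embeddings[OF KN])
  have finM: "finite (embeddings L K M)"
    by (rule finite_embeddings[OF finite_field_ext_lower[OF KN M]])
  have fib: "card (?fib \<phi>) = card (embeddings L M N)" if \<phi>: "\<phi> \<in> embeddings L K M" for \<phi>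
  proof -
    obtain g where g: "g \<in> embeddings L K N" "restrict g M = \<phi>"
      using extend_embedding[OF KN M \<phi>] .
    let ?g' = "restrict (inv_into N g) N"
    note g' = inv_embeddings[OF K(2) g(1) K(3), unfolded N[OF g(1)]]
    have gg': "g (?g' x) = x" "?g' (g x) = x" "?g' x \<in> N" "g x \<in> N" if "x \<in> N" for x
      using that N[OF g(1)] subfield_hom_inj[OF K(2) embeddingsD(1)[OF g(1)]] g'(2)
      by (auto simp: f_inv_into_f)
    have "bij_betw (compose N g) (embeddings L M N) (?fib \<phi>)"
    proof (rule bij_betw_byWitness[where f' = "compose N ?g'"])
      show "\<forall>\<psi>\<in>embeddings L M N. compose N ?g' (compose N g \<psi>) = \<psi>"
      proof
        fix \<psi> assume \<psi>: "\<psi> \<in> embeddings L M N"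
        have "\<psi> x \<in> N" if "x \<in> N" for x using N \<psi> MN that by blast
        then show "compose N ?g' (compose N g \<psi>) = \<psi>"
          using gg'(2,4) embeddingsD(2)[OF \<psi>]
          by (intro extensionalityI[of _ N]) (auto simp: compose_eq)
      qed
      show "\<forall>\<psi>\<in>?fib \<phi>. compose N g (compose N ?g' \<psi>) = \<psi>"
      proof
        fix \<psi> assume \<psi>: "\<psi> \<in> ?fib \<phi>"
        have "\<psi> x \<in> N" if "x \<in> N" for x using N \<psi> that by blast
        then show "compose N g (compose N ?g' \<psi>) = \<psi>"
          using gg'(1,3) embeddingsD(2)[of \<psi> L K N] \<psi>
          by (intro extensionalityI[of _ N]) (auto simp: compose_eq)
      qed
      show "compose N g ` embeddings L M N \<subseteq> ?fib \<phi>"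
      proof (rule image_subsetI)
        fix \<psi> assume \<psi>: "\<psi> \<in> embeddings L M N"
        then have \<psi>': "\<psi> \<in> embeddings L K N" using MN by blast
        have "compose N g \<psi> \<in> embeddings L K N"
          using N[OF \<psi>'] by (intro compose_embeddings[OF K(2,2) g(1) \<psi>' _ K(3)]) auto
        moreover have "restrict (compose N g \<psi>) M = restrict g M"
          using embeddingsD(3)[OF \<psi>] M(3) by (intro restrict_ext) (auto simp: compose_eq)
        ultimately show "compose N g \<psi> \<in> ?fib \<phi>" using g(2) by simp
      qed
      show "compose N ?g' ` ?fib \<phi> \<subseteq> embeddings L M N"
      proof (rule image_subsetI)
        fix \<psi> assume \<psi>: "\<psi> \<in> ?fib \<phi>"
        then have \<psi>': "\<psi> \<in> embeddings L K N" and r: "restrict \<psi> M = restrict g M" using g(2) by auto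
        have "compose N ?g' \<psi> \<in> embeddings L K N"
          using N[OF \<psi>'] by (intro compose_embeddings[OF K(2,2) g'(1) \<psi>' _ K(3)]) auto
        moreover have "compose N ?g' \<psi> x = x" if "x \<in> M" for x
        proof -
          have "\<psi> x = g x" using fun_cong[OF r, of x] that by simp
          then show ?thesis using that M(3) gg'(2)[of x] by (auto simp: compose_eq)
        qed
        ultimately show "compose N ?g' \<psi> \<in> embeddings L M N"
          unfolding embeddings_def by auto
      qed
    qed
    then show ?thesis by (simp add: bij_betw_same_card)
  qed
  have "embeddings L K N = (\<Union>\<phi>\<in>embeddings L K M. ?fib \<phi>)"
    using restrict_embeddings[OF M(1) K(2) M(3) _ M(2)] by auto
  then have "card (embeddings L K N) = (\<Sum>\<phi>\<in>embeddings L K M. card (?fib \<phi>))"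
    using card_UN_disjoint[of "embeddings L K M" ?fib] fin finM by fastforce
  also have "\<dots> = card (embeddings L K M) * card (embeddings L M N)"
    using fib by simp
  finally show ?thesis by simp
qed

lemma card_embeddings_pos:
  assumes "finite_field_ext L K E"
  shows "card (embeddings L K E) > 0"
proof -
  note K = finite_field_extD[OF assms]
  have "(\<lambda>x\<in>E. x) \<in> embeddings L K E" by (rule identity_embedding[OF K(2,3)])
  then show ?thesis using finite_embeddings[OF assms] card_gt_0_iff by blast
qed

text \<open>The stable case applied to the three towers K, M, N and M, E, N and K, E, N; the
  positive factor \<open>card (embeddings L E N)\<close> cancels.\<close>

lemma card_embeddings_mult:
  assumes KE: "finite_field_ext L K E" and M: "subfield M L" "K \<subseteq> M" "M \<subseteq> E"
  shows "card (embeddings L K E) = card (embeddings L K M) * card (embeddings L M E)"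
proof -
  note K = finite_field_extD[OF KE]
  obtain N where KN: "finite_field_ext L K N" and EN: "E \<subseteq> N"
    and N: "\<And>\<phi>. \<phi> \<in> embeddings L K N \<Longrightarrow> \<phi> ` N = N"
    using finite_normal_closure[OF KE] by blast
  have MN: "M \<subseteq> N" and KE': "K \<subseteq> E" using M EN by auto
  note MN' = finite_field_ext_upper[OF KN M(1,2) MN]
  have NM: "\<phi> ` N = N" if "\<phi> \<in> embeddings L M N" for \<phi>
    using N embeddings_antimono[OF M(2), of N] that by blast
  have 1: "card (embeddings L K M) * card (embeddings L M N) = card (embeddings L K N)"
    by (rule card_embeddings_mult_stable[OF KN M(1,2) MN N])
  have 2: "card (embeddings L M E) * card (embeddings L E N) = card (embeddings L M N)"
    by (rule card_embeddings_mult_stable[OF MN' K(2) M(3) EN NM])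
  have 3: "card (embeddings L K E) * card (embeddings L E N) = card (embeddings L K N)"
    by (rule card_embeddings_mult_stable[OF KN K(2,3) EN N])
  have "card (embeddings L E N) > 0"
    by (rule card_embeddings_pos[OF finite_field_ext_upper[OF KN K(2) _ EN]]) (rule K(3))
  moreover have "card (embeddings L K E) * card (embeddings L E N)
      = (card (embeddings L K M) * card (embeddings L M E)) * card (embeddings L E N)"
    unfolding 3 mult.assoc 2 1 ..
  ultimately show ?thesis by simp
qed

end

section \<open>Separability\<close>

text \<open>For a multiset of roots this links the two faces of separability: all roots simple, and
  as many distinct roots as the degree.\<close>

lemma card_set_mset_eq_size_iff:
  "card (set_mset M) = size M \<longleftrightarrow> (\<forall>a. count M a \<le> 1)"
proof
  assume eq: "card (set_mset M) = size M"
  show "\<forall>a. count M a \<le> 1"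
  proof (rule ccontr)
    assume "\<not> (\<forall>a. count M a \<le> 1)"
    then obtain a where a: "1 < count M a" by (auto simp: not_le)
    then have "a \<in># M" by (meson count_greater_zero_iff less_trans zero_less_one)
    have "(\<Sum>a\<in>set_mset M. 1) < (\<Sum>a\<in>set_mset M. count M a)"
      by (rule sum_strict_mono_ex1) (use a \<open>a \<in># M\<close> in \<open>auto simp: Suc_le_eq\<close>)
    then show False using eq by (simp add: size_multiset_overloaded_eq)
  qed
next
  assume le: "\<forall>a. count M a \<le> 1"
  have "count M a = 1" if "a \<in># M" for a
  proof -
    have "count M a > 0" using that by simp
    then show ?thesis using spec[OF le, of a] by linarith
  qed
  then show "card (set_mset M) = size M" by (simp add: size_multiset_overloaded_eq)
qed

lemma card_set_mset_le_size: "card (set_mset M) \<le> size M"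
  unfolding size_multiset_overloaded_eq card_eq_sum
  by (rule sum_mono) (simp add: Suc_le_eq)

context field
begin

text \<open>The minimal polynomial over the larger field divides the one over the smaller field, so
  root multiplicities can only drop.\<close>

lemma separable_element_mono:
  assumes K: "subfield K R" and M: "subfield M R" "K \<subseteq> M"
    and x: "x \<in> carrier R" "separable_element R K x"
  shows "separable_element R M x"
proof -
  have algK: "(algebraic over K) x" using x(2) by (simp add: separable_element_def over_def)
  have algM: "(algebraic over M) x" by (rule algebraic_mono[OF M(2) algK])
  note iK = IrrE[OF K x(1) algK] and iM = IrrE[OF M(1) x(1) algM]
  have pK: "Irr K x \<in> carrier (poly_ring R)" "Irr K x \<noteq> []"
    using carrier_polynomial_shell[OF subfieldE(1)[OF K] iK(1)]
      pirreducibleE(1)[OF subfieldE(1)[OF K] iK(1,2)] by auto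
  have pM: "Irr M x \<in> carrier (poly_ring R)"
    using carrier_polynomial_shell[OF subfieldE(1)[OF M(1)] iM(1)] .
  have "Irr K x \<in> carrier (M[X])"
    using iK(1) M(2) unfolding univ_poly_carrier[symmetric] polynomial_def by auto
  then have "Irr M x pdivides Irr K x"
    using Irr_minimal[OF M(1) x(1) algM] iK(4) by blast
  then have "roots (Irr M x) \<subseteq># roots (Irr K x)"
    by (rule pdivides_imp_roots_incl[OF pM pK])
  then have "alg_mult (Irr M x) a \<le> alg_mult (Irr K x) a" for a
    using alg_mult_eq_count_roots[OF pM] alg_mult_eq_count_roots[OF pK(1)]
    by (simp add: mset_subset_eq_count)
  then show ?thesis
    using x(2) algM unfolding separable_element_def over_def by (meson le_trans)
qed

lemma finite_field_ext_simple_extension: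
  assumes "subfield K R" "x \<in> carrier R" "(algebraic over K) x"
  shows "finite_field_ext R K (simple_extension K x)"
  using finite_field_ext_finite_extension[OF assms(1), of "[x]"] assms(2,3) by simp

end

section \<open>Distinct roots, degree and separability\<close>

context algebraically_closed
begin

lemma card_roots:
  assumes "p \<in> carrier (poly_ring L)" "p \<noteq> []"
  shows "card {b \<in> carrier L. eval p b = \<zero>} \<le> degree p"
    and "card {b \<in> carrier L. eval p b = \<zero>} = degree p \<longleftrightarrow> (\<forall>a\<in>carrier L. alg_mult p a \<le> 1)"
proof -
  have 1: "{b \<in> carrier L. eval p b = \<zero>} = set_mset (roots p)"
    using roots_mem_iff_is_root[OF assms(1)] assms(2) by (auto simp: is_root_def)
  have 2: "size (roots p) = degree p"
    using roots_over_carrier[OF assms(1)] by (simp add: splitted_def)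
  show "card {b \<in> carrier L. eval p b = \<zero>} \<le> degree p"
    unfolding 1 2[symmetric] by (rule card_set_mset_le_size)
  \<comment> \<open>The multiset criterion ranges over all \<open>a\<close>, separability only over
    the carrier; outside it \<open>alg_mult\<close> has the default value 0.\<close>
  have "alg_mult p a = 0" if "a \<notin> carrier L" for a
    using that by (simp add: alg_mult_def)
  then show "card {b \<in> carrier L. eval p b = \<zero>} = degree p \<longleftrightarrow> (\<forall>a\<in>carrier L. alg_mult p a \<le> 1)"
    unfolding 1 2[symmetric] card_set_mset_eq_size_iff alg_mult_eq_count_roots[OF assms(1), symmetric]
    by (metis zero_le)
qed

lemma card_embeddings_simple_extension:
  assumes K: "subfield K L" and x: "x \<in> carrier L" "(algebraic over K) x"
  shows "card (embeddings L K (simple_extension K x)) = card {b \<in> carrier L. eval (Irr K x) b = \<zero>}"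
proof -
  let ?E = "simple_extension K x"
  note KE = finite_field_ext_simple_extension[OF K x]
  note E = finite_field_extD[OF KE]
  have xE: "x \<in> ?E" by (rule simple_extension_mem[OF subfieldE(1)[OF K] x(1)])
  have id: "(\<lambda>y. y) \<in> ring_hom (L\<lparr>carrier := K\<rparr>) L"
    by (rule ring_hom_memI) (use E(6) in auto)
  have "bij_betw (\<lambda>\<phi>. \<phi> x) (embeddings L K ?E) {b \<in> carrier L. eval (Irr K x) b = \<zero>}"
    unfolding bij_betw_def
  proof
    show "inj_on (\<lambda>\<phi>. \<phi> x) (embeddings L K ?E)"
    proof (rule inj_onI)
      fix \<phi> \<psi> assume \<phi>: "\<phi> \<in> embeddings L K ?E" and \<psi>: "\<psi> \<in> embeddings L K ?E" and eq: "\<phi> x = \<psi> x"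
      have 0: "?E = finite_extension K [x]" by simp
      have 1: "\<phi> y = \<psi> y" if "y \<in> set [x]" for y using eq that by simp
      have 2: "\<phi> y = \<psi> y" if "y \<in> K" for y
        using embeddingsD(3)[OF \<phi> that] embeddingsD(3)[OF \<psi> that] by simp
      have 3: "set [x] \<subseteq> ?E" using xE by simp
      show "\<phi> = \<psi>"
        by (rule embeddings_eqI[OF \<phi> \<psi>])
          (rule subfield_hom_ext_finite_extension[OF E(2) 0 embeddingsD(1)[OF \<phi>]
              embeddingsD(1)[OF \<psi>] E(3) 2 3 1])
    qed
    show "(\<lambda>\<phi>. \<phi> x) ` embeddings L K ?E = {b \<in> carrier L. eval (Irr K x) b = \<zero>}"
    proof
      show "(\<lambda>\<phi>. \<phi> x) ` embeddings L K ?E \<subseteq> {b \<in> carrier L. eval (Irr K x) b = \<zero>}"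
        using embeddings_Irr_root[OF KE _ xE] by auto
      show "{b \<in> carrier L. eval (Irr K x) b = \<zero>} \<subseteq> (\<lambda>\<phi>. \<phi> x) ` embeddings L K ?E"
      proof
        fix b assume b: "b \<in> {b \<in> carrier L. eval (Irr K x) b = \<zero>}"
        then obtain g where g: "g \<in> ring_hom (L\<lparr>carrier := ?E\<rparr>) L" "\<And>k. k \<in> K \<Longrightarrow> g k = k" "g x = b"
          using extend_hom_simple_extension[OF K id x, of b] by auto
        have "restrict g ?E \<in> embeddings L K ?E"
          using g E(3) subringE[OF subfieldE(1)[OF E(2)]]
          unfolding embeddings_def by (auto intro!: ring_hom_memI simp: ring_hom_memE[OF g(1), simplified])
        then show "b \<in> (\<lambda>\<phi>. \<phi> x) ` embeddings L K ?E"
          using g(3) xE by (intro image_eqI[of _ _ "restrict g ?E"]) auto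
      qed
    qed
  qed
  then show ?thesis by (rule bij_betw_same_card)
qed

lemma card_embeddings_simple_extension_le:
  assumes K: "subfield K L" and x: "x \<in> carrier L" "(algebraic over K) x"
  shows "card (embeddings L K (simple_extension K x)) \<le> dim K (simple_extension K x)"
    and "card (embeddings L K (simple_extension K x)) = dim K (simple_extension K x)
           \<longleftrightarrow> separable_element L K x"
proof -
  note i = IrrE[OF K x]
  have p: "Irr K x \<in> carrier (poly_ring L)" "Irr K x \<noteq> []"
    using carrier_polynomial_shell[OF subfieldE(1)[OF K] i(1)]
      pirreducibleE(1)[OF subfieldE(1)[OF K] i(1,2)] by auto
  have d: "dim K (simple_extension K x) = degree (Irr K x)"
    using simple_extension_dim[OF K x] unfolding over_def .
  show "card (embeddings L K (simple_extension K x)) \<le> dim K (simple_extension K x)"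
    unfolding card_embeddings_simple_extension[OF K x] d by (rule card_roots(1)[OF p])
  show "card (embeddings L K (simple_extension K x)) = dim K (simple_extension K x)
           \<longleftrightarrow> separable_element L K x"
    unfolding card_embeddings_simple_extension[OF K x] d card_roots(2)[OF p]
    using x(2) by (simp add: separable_element_def over_def)
qed

lemma embeddings_self:
  assumes "subfield K L"
  shows "card (embeddings L K K) = 1"
proof -
  have "embeddings L K K \<subseteq> {\<lambda>y\<in>K. y}"
    by (auto simp: embeddings_def extensional_def fun_eq_iff)
  then have "card (embeddings L K K) \<le> 1"
    using card_mono[of "{\<lambda>y\<in>K. y}"] by fastforce
  then show ?thesis
    using card_embeddings_pos[OF finite_field_ext_refl(1)[OF assms]] by simp
qed

text \<open>Along the generators both the count and the degree multiply, and each step is a simple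
  extension. Bound and equality share one induction; in the equality case a generator separable over
  \<open>K\<close> stays separable over the field reached so far.\<close>

lemma card_embeddings_finite_extension:
  assumes K: "subfield K L" and xs: "set xs \<subseteq> carrier L" "\<And>x. x \<in> set xs \<Longrightarrow> (algebraic over K) x"
  shows "card (embeddings L K (finite_extension K xs)) \<le> dim K (finite_extension K xs) \<and>
    ((\<forall>x\<in>set xs. separable_element L K x) \<longrightarrow>
      card (embeddings L K (finite_extension K xs)) = dim K (finite_extension K xs))"
  using xs
proof (induction xs)
  case Nil
  then show ?case using embeddings_self[OF K] finite_field_ext_refl(2)[OF K] by simp
next
  case (Cons x xs)
  let ?M = "finite_extension K xs" and ?E = "finite_extension K (x # xs)"
  have KM: "finite_field_ext L K ?M"
    by (rule finite_field_ext_finite_extension[OF K]) (use Cons(2,3) in auto)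
  have KE: "finite_field_ext L K ?E"
    by (rule finite_field_ext_finite_extension[OF K]) (use Cons(2,3) in auto)
  note M = finite_field_extD[OF KM] and E = finite_field_extD[OF KE]
  have x: "x \<in> carrier L" "(algebraic over ?M) x"
    using Cons(2,3) algebraic_mono[OF M(3)] by auto
  have ME: "finite_field_ext L ?M ?E"
    using finite_field_ext_simple_extension[OF M(2) x] by simp
  have c: "card (embeddings L K ?E) = card (embeddings L K ?M) * card (embeddings L ?M ?E)"
    by (rule card_embeddings_mult[OF KE M(2,3) finite_field_extD(3)[OF ME]])
  have d: "dim K ?E = dim K ?M * dim ?M ?E"
    by (rule finite_field_ext_trans(2)[OF KM ME])
  have IH: "card (embeddings L K ?M) \<le> dim K ?M"
    "\<forall>x\<in>set xs. separable_element L K x \<Longrightarrow> card (embeddings L K ?M) = dim K ?M"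
    using Cons by auto
  have le: "card (embeddings L ?M ?E) \<le> dim ?M ?E"
    using card_embeddings_simple_extension_le(1)[OF M(2) x] by simp
  have eq: "card (embeddings L ?M ?E) = dim ?M ?E" if "separable_element L K x"
    using card_embeddings_simple_extension_le(2)[OF M(2) x]
      separable_element_mono[OF K M(2,3) x(1) that] by simp
  show ?case
    unfolding c d using IH le eq by (simp add: mult_le_mono)
qed

lemma card_embeddings_le_dim:
  assumes "finite_field_ext L K E"
  shows "card (embeddings L K E) \<le> dim K E"
proof -
  note K = finite_field_extD[OF assms]
  obtain xs where xs: "set xs \<subseteq> E" "E = finite_extension K xs"
    using finite_field_ext_generators[OF assms] .
  have "set xs \<subseteq> carrier L" "\<And>x. x \<in> set xs \<Longrightarrow> (algebraic over K) x"
    using xs(1) K(7,8) by blast+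
  then show ?thesis
    using card_embeddings_finite_extension[OF K(1), of xs] unfolding xs(2)[symmetric] by blast
qed

text \<open>From equality to separability: in the tower K, K(x), E each count is at most the
  corresponding degree, so equality of the products forces equality at K(x), which says that
  \<open>x\<close> is separable.\<close>

lemma card_embeddings_eq_dim_iff:
  assumes KE: "finite_field_ext L K E"
  shows "card (embeddings L K E) = dim K E \<longleftrightarrow> separable_ext L K E"
proof
  note K = finite_field_extD[OF KE]
  assume eq: "card (embeddings L K E) = dim K E"
  show "separable_ext L K E"
    unfolding separable_ext_def
  proof
    fix x assume x: "x \<in> E"
    let ?M = "simple_extension K x"
    note Kx = K(1) K(8)[OF x] K(7)[OF x]
    note KM = finite_field_ext_simple_extension[OF Kx]
    note M = finite_field_extD[OF KM]
    have sub: "?M \<subseteq> E"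
      by (rule simple_extension_subring_incl[OF subfieldE(1)[OF K(2)] K(3) x])
    note ME = finite_field_ext_upper[OF KE M(2,3) sub]
    have "card (embeddings L K ?M) * card (embeddings L ?M E) = dim K ?M * dim ?M E"
      using eq card_embeddings_mult[OF KE M(2,3) sub] finite_field_ext_trans(2)[OF KM ME] by simp
    moreover have "card (embeddings L K ?M) \<le> dim K ?M" "card (embeddings L ?M E) \<le> dim ?M E"
      using card_embeddings_le_dim KM ME by auto
    moreover have "dim ?M E > 0" "card (embeddings L K ?M) > 0"
      using finite_field_ext_dim_pos[OF ME] card_embeddings_pos[OF KM] by auto
    \<comment> \<open>A strict inequality in the first factor would survive multiplication, because
      the second count is positive.\<close>
    ultimately have "\<not> card (embeddings L K ?M) < dim K ?M"
      using mult_less_le_imp_less[of "card (embeddings L K ?M)" "dim K ?M"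
          "card (embeddings L ?M E)" "dim ?M E"] card_embeddings_pos[OF ME] by linarith
    with \<open>card (embeddings L K ?M) \<le> dim K ?M\<close> have "card (embeddings L K ?M) = dim K ?M"
      by simp
    then show "separable_element L K x"
      using card_embeddings_simple_extension_le(2)[OF Kx] by simp
  qed
next
  note K = finite_field_extD[OF KE]
  assume sep: "separable_ext L K E"
  obtain xs where xs: "set xs \<subseteq> E" "E = finite_extension K xs"
    using finite_field_ext_generators[OF KE] .
  have "set xs \<subseteq> carrier L" "\<And>x. x \<in> set xs \<Longrightarrow> (algebraic over K) x"
    "\<forall>x\<in>set xs. separable_element L K x"
    using xs(1) K(7,8) sep unfolding separable_ext_def by blast+
  then show "card (embeddings L K E) = dim K E"
    using card_embeddings_finite_extension[OF K(1), of xs] unfolding xs(2)[symmetric] by blast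
qed

text \<open>Separable generators make the count reach the degree, and that forces every element to
  be separable. This yields closure of separable elements under the field operations.\<close>

lemma separable_ext_finite_extension:
  assumes K: "subfield K L" and xs: "set xs \<subseteq> carrier L" "\<And>x. x \<in> set xs \<Longrightarrow> separable_element L K x"
  shows "finite_field_ext L K (finite_extension K xs)" "separable_ext L K (finite_extension K xs)"
proof -
  have alg: "(algebraic over K) x" if "x \<in> set xs" for x
    using xs(2)[OF that] by (simp add: separable_element_def over_def)
  show KE: "finite_field_ext L K (finite_extension K xs)"
    by (rule finite_field_ext_finite_extension[OF K xs(1) alg])
  show "separable_ext L K (finite_extension K xs)"
    using card_embeddings_finite_extension[OF K xs(1) alg] xs(2)
    unfolding card_embeddings_eq_dim_iff[OF KE, symmetric] by blast
qed

section \<open>The maximal separable subextension\<close>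

lemma separable_elements_subfield:
  assumes KE: "finite_field_ext L K E"
  shows "subfield {x \<in> E. separable_element L K x} L" (is "subfield ?S L")
proof -
  note K = finite_field_extD[OF KE]
  note sE = subringE[OF subfieldE(1)[OF K(2)]]
  \<comment> \<open>Each sum, product or inverse lies in the field generated by its operands, so one
    claim about generated fields covers all operations.\<close>
  have sep: "z \<in> ?S"
    if "set xs \<subseteq> ?S" "z \<in> finite_extension K xs" for xs z
  proof -
    have "finite_extension K xs \<subseteq> E"
      by (rule finite_extension_subring_incl[OF subfieldE(1)[OF K(2)] K(3)]) (use that in auto)
    moreover have "separable_ext L K (finite_extension K xs)"
      by (rule separable_ext_finite_extension(2)[OF K(1)]) (use that K(8) in auto)
    ultimately show ?thesis using that(2) unfolding separable_ext_def by blast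
  qed
  have mem: "subfield (finite_extension K xs) L" "set xs \<subseteq> finite_extension K xs"
    if "set xs \<subseteq> ?S" for xs
  proof -
    have "finite_field_ext L K (finite_extension K xs)"
      by (rule separable_ext_finite_extension(1)[OF K(1)]) (use that K(8) in auto)
    then show "subfield (finite_extension K xs) L" by (rule finite_field_extD(2))
    show "set xs \<subseteq> finite_extension K xs"
      by (rule finite_extension_mem[OF subfieldE(1)[OF K(1)]]) (use that K(8) in auto)
  qed
  show ?thesis
  proof (rule subfieldI'[OF subringI])
    show "?S \<subseteq> carrier L" using K(5) by auto
    show "\<one> \<in> ?S"
      by (rule sep[of "[]"]) (use subringE(3)[OF subfieldE(1)[OF K(1)]] in auto)
  next
    fix x assume x: "x \<in> ?S"
    note m = mem[of "[x]"]
    show "\<ominus> x \<in> ?S"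
      by (rule sep[of "[x]"]) (use x m subringE(5)[OF subfieldE(1)[OF m(1)]] in auto)
    fix y assume y: "y \<in> ?S"
    note m = mem[of "[x, y]"]
    show "x \<otimes> y \<in> ?S"
      by (rule sep[of "[x, y]"]) (use x y m subringE(6)[OF subfieldE(1)[OF m(1)]] in auto)
    show "x \<oplus> y \<in> ?S"
      by (rule sep[of "[x, y]"]) (use x y m subringE(7)[OF subfieldE(1)[OF m(1)]] in auto)
  next
    fix x assume x: "x \<in> ?S - {\<zero>}"
    note m = mem[of "[x]"]
    show "inv x \<in> ?S"
      by (rule sep[of "[x]"]) (use x m subfield_m_inv(1)[OF m(1), of x] in auto)
  qed
qed

text \<open>The separable elements form an admissible field and contain every other one, so
  \<open>GREATEST\<close> is attained and membership becomes a condition on single elements.\<close>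

lemma max_separable_eq:
  assumes KE: "finite_field_ext L K E"
  shows "max_separable L K E = {x \<in> E. separable_element L K x}" (is "_ = ?S")
  unfolding max_separable_def
proof (rule Greatest_equality)
  note K = finite_field_extD[OF KE]
  have "x \<in> ?S" if "x \<in> K" for x
    using separable_ext_finite_extension(2)[OF K(1), of "[]"] that K(3)
    by (auto simp: separable_ext_def)
  then show "intermediate_field L K ?S E \<and> separable_ext L K ?S"
    using separable_elements_subfield[OF KE] by (auto simp: intermediate_field_def separable_ext_def)
next
  fix M assume "intermediate_field L K M E \<and> separable_ext L K M"
  then show "M \<subseteq> ?S" by (auto simp: intermediate_field_def separable_ext_def)
qed

lemma max_separable_props:
  assumes KE: "finite_field_ext L K E"
  shows "subfield (max_separable L K E) L" "K \<subseteq> max_separable L K E" "max_separable L K E \<subseteq> E"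
    "separable_ext L K (max_separable L K E)"
proof -
  note K = finite_field_extD[OF KE]
  show "subfield (max_separable L K E) L"
    unfolding max_separable_eq[OF KE] by (rule separable_elements_subfield[OF KE])
  have "x \<in> {x \<in> E. separable_element L K x}" if "x \<in> K" for x
    using separable_ext_finite_extension(2)[OF K(1), of "[]"] that K(3)
    by (auto simp: separable_ext_def)
  then show "K \<subseteq> max_separable L K E" unfolding max_separable_eq[OF KE] by blast
  show "max_separable L K E \<subseteq> E" "separable_ext L K (max_separable L K E)"
    unfolding max_separable_eq[OF KE] by (auto simp: separable_ext_def)
qed

lemma max_separable_ext:
  assumes KE: "finite_field_ext L K E"
  shows "finite_field_ext L K (max_separable L K E)" "finite_field_ext L (max_separable L K E) E"
  using finite_field_ext_lower[OF KE max_separable_props(1-3)[OF KE]]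
    finite_field_ext_upper[OF KE max_separable_props(1-3)[OF KE]] .

text \<open>Transitivity of separability by counting: with S the maximal separable subfield, the
  count equals the degree on both steps of the tower K, S, S(x), hence also from \<open>K\<close> to
  S(x).\<close>

lemma separable_element_over_max_separable:
  assumes KE: "finite_field_ext L K E" and x: "x \<in> E" "separable_element L (max_separable L K E) x"
  shows "x \<in> max_separable L K E"
proof -
  note K = finite_field_extD[OF KE]
  let ?S = "max_separable L K E"
  let ?M = "finite_extension ?S [x]"
  note S = max_separable_props[OF KE]
  note KS = max_separable_ext(1)[OF KE]
  have xs: "set [x] \<subseteq> carrier L" "\<And>y. y \<in> set [x] \<Longrightarrow> separable_element L ?S y"
    using x K(8) by auto
  note SM = separable_ext_finite_extension[OF S(1) xs]
  note KM = finite_field_ext_trans[OF KS SM(1)]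
  note M = finite_field_extD[OF SM(1)]
  have "card (embeddings L K ?M) = card (embeddings L K ?S) * card (embeddings L ?S ?M)"
    by (rule card_embeddings_mult[OF KM(1) S(1,2) M(3)])
  also have "\<dots> = dim K ?S * dim ?S ?M"
    using SM(2) S(4) card_embeddings_eq_dim_iff[OF SM(1)] card_embeddings_eq_dim_iff[OF KS] by simp
  also have "\<dots> = dim K ?M" by (rule KM(2)[symmetric])
  finally have "separable_ext L K ?M"
    using card_embeddings_eq_dim_iff[OF KM(1)] by blast
  moreover have "x \<in> ?M"
    using finite_extension_mem[OF subfieldE(1)[OF S(1)] xs(1)] by auto
  ultimately show ?thesis
    unfolding max_separable_eq[OF KE] separable_ext_def using x(1) by blast
qed

end

section \<open>Purely inseparable extensions\<close>

text \<open>The dual numbers \<open>R[\<epsilon>]/(\<epsilon>\<^sup>2)\<close>: evaluating \<open>p\<close> at \<open>x + \<epsilon>\<close> yields \<open>p(x) + p'(x) \<epsilon>\<close>.\<close>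

definition dual_numbers :: "('a, 'b) ring_scheme \<Rightarrow> ('a \<times> 'a) ring" where
  "dual_numbers R =
     \<lparr>carrier = carrier R \<times> carrier R,
      monoid.mult = (\<lambda>(a, b) (c, d). (a \<otimes>\<^bsub>R\<^esub> c, (a \<otimes>\<^bsub>R\<^esub> d) \<oplus>\<^bsub>R\<^esub> (b \<otimes>\<^bsub>R\<^esub> c))),
      one = (\<one>\<^bsub>R\<^esub>, \<zero>\<^bsub>R\<^esub>), zero = (\<zero>\<^bsub>R\<^esub>, \<zero>\<^bsub>R\<^esub>),
      add = (\<lambda>(a, b) (c, d). (a \<oplus>\<^bsub>R\<^esub> c, b \<oplus>\<^bsub>R\<^esub> d))\<rparr>"

text \<open>Coefficient lists start with the leading coefficient, so \<open>length (b # p)\<close>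
  is the exponent belonging to \<open>a\<close>. Leading zeros are kept, which makes the length
  predictable; \<open>normalize\<close> is applied where a genuine polynomial is required.\<close>

fun (in ring) formal_deriv :: "'a list \<Rightarrow> 'a list" where
  "formal_deriv [] = []"
| "formal_deriv [a] = []"
| "formal_deriv (a # b # p) = ([length (b # p)] \<cdot> a) # formal_deriv (b # p)"

lemma (in ring) length_formal_deriv: "length (formal_deriv p) = length p - 1"
  by (induction p rule: formal_deriv.induct) auto

lemma (in ring) add_pow_subring_closed:
  assumes "subring K R" "a \<in> K" shows "[(n::nat)] \<cdot> a \<in> K"
  using subringE[OF assms(1)] assms(2) by (induction n) auto

lemma (in ring) set_formal_deriv:
  assumes "subring K R" "set p \<subseteq> K" shows "set (formal_deriv p) \<subseteq> K"
  using assms(2) add_pow_subring_closed[OF assms(1)] subringE(7)[OF assms(1)]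
  by (induction p rule: formal_deriv.induct) auto

section \<open>Evaluation in the dual numbers\<close>

context cring
begin

lemma dual_numbers_cring: "cring (dual_numbers R)"
proof (rule cringI)
  show "abelian_group (dual_numbers R)"
  proof (rule abelian_groupI)
    fix x assume "x \<in> carrier (dual_numbers R)"
    then obtain a b where x: "x = (a, b)" "a \<in> carrier R" "b \<in> carrier R"
      by (auto simp: dual_numbers_def)
    show "\<exists>y\<in>carrier (dual_numbers R). y \<oplus>\<^bsub>dual_numbers R\<^esub> x = \<zero>\<^bsub>dual_numbers R\<^esub>"
      by (rule bexI[of _ "(\<ominus> a, \<ominus> b)"]) (use x in \<open>auto simp: dual_numbers_def l_neg\<close>)
  qed (auto simp: dual_numbers_def a_ac)
  show "comm_monoid (dual_numbers R)"
    by (rule comm_monoidI) (auto simp: dual_numbers_def m_ac a_ac l_distr r_distr)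
qed (auto simp: dual_numbers_def l_distr a_ac)

lemma dual_numbers_hom: "(\<lambda>a. (a, \<zero>)) \<in> ring_hom R (dual_numbers R)"
  by (rule ring_hom_memI) (auto simp: dual_numbers_def)

text \<open>The expansion of (x + \<epsilon>)^n. For n = 0 the truncated exponent
  \<open>n - 1\<close> is harmless, since its multiple by 0 vanishes.\<close>

lemma dual_numbers_pow:
  assumes "x \<in> carrier R"
  shows "(x, \<one>) [^]\<^bsub>dual_numbers R\<^esub> (n::nat) = (x [^] n, [n] \<cdot> (x [^] (n - 1)))"
proof (induction n)
  case 0
  then show ?case by (simp add: dual_numbers_def)
next
  case (Suc n)
  interpret D: cring "dual_numbers R" by (rule dual_numbers_cring)
  have "(x, \<one>) [^]\<^bsub>dual_numbers R\<^esub> Suc n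
      = (x [^] n, [n] \<cdot> (x [^] (n - 1))) \<otimes>\<^bsub>dual_numbers R\<^esub> (x, \<one>)"
    using Suc by simp
  also have "\<dots> = (x [^] Suc n, x [^] n \<oplus> [n] \<cdot> (x [^] (n - 1) \<otimes> x))"
    using assms by (simp add: dual_numbers_def add_pow_ldistr)
  also have "[n] \<cdot> (x [^] (n - 1) \<otimes> x) = [n] \<cdot> (x [^] n)"
    using assms by (cases n) auto
  finally show ?case using assms by (simp add: a_comm)
qed

lemma eval_dual_numbers:
  assumes "set p \<subseteq> carrier R" "x \<in> carrier R"
  shows "ring.eval (dual_numbers R) (map (\<lambda>a. (a, \<zero>)) p) (x, \<one>) = (eval p x, eval (formal_deriv p) x)"
  using assms(1)
proof (induction p rule: formal_deriv.induct)
  interpret D: cring "dual_numbers R" by (rule dual_numbers_cring)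
  case 1
  then show ?case by (simp add: D.eval.simps) (simp add: dual_numbers_def)
next
  interpret D: cring "dual_numbers R" by (rule dual_numbers_cring)
  case (2 a)
  then show ?case by (simp add: D.eval.simps) (simp add: dual_numbers_def)
next
  interpret D: cring "dual_numbers R" by (rule dual_numbers_cring)
  case (3 a b p)
  let ?n = "length (b # p)"
  have IH: "D.eval (map (\<lambda>a. (a, \<zero>)) (b # p)) (x, \<one>) = (eval (b # p) x, eval (formal_deriv (b # p)) x)"
    using 3 by simp
  have cl: "a \<in> carrier R" "eval (b # p) x \<in> carrier R" "eval (formal_deriv (b # p)) x \<in> carrier R"
    using 3(2) assms(2) eval_in_carrier set_formal_deriv[OF carrier_is_subring, of "b # p"] by auto
  have "D.eval (map (\<lambda>a. (a, \<zero>)) (a # b # p)) (x, \<one>)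
      = (a, \<zero>) \<otimes>\<^bsub>dual_numbers R\<^esub> (x, \<one>) [^]\<^bsub>dual_numbers R\<^esub> ?n
        \<oplus>\<^bsub>dual_numbers R\<^esub> D.eval (map (\<lambda>a. (a, \<zero>)) (b # p)) (x, \<one>)"
    by (simp del: nat_pow_Suc D.nat_pow_Suc)
  also have "\<dots> = (a \<otimes> x [^] ?n \<oplus> eval (b # p) x,
      a \<otimes> ([?n] \<cdot> (x [^] (?n - 1))) \<oplus> eval (formal_deriv (b # p)) x)"
    unfolding IH dual_numbers_pow[OF assms(2)] using cl assms(2)
    by (simp add: dual_numbers_def del: eval.simps nat_pow_Suc add.nat_pow_Suc)
  also have "a \<otimes> ([?n] \<cdot> (x [^] (?n - 1))) = ([?n] \<cdot> a) \<otimes> x [^] (?n - 1)"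
    using cl(1) assms(2) by (simp add: add_pow_ldistr add_pow_rdistr del: add.nat_pow_Suc)
  finally show ?case by (simp add: length_formal_deriv)
qed

lemma dual_numbers_const_closed:
  "set p \<subseteq> carrier R \<Longrightarrow> set (map (\<lambda>a. (a, \<zero>)) p) \<subseteq> carrier (dual_numbers R)"
  by (auto simp: dual_numbers_def)

lemma dual_numbers_root_closed: "x \<in> carrier R \<Longrightarrow> (x, \<one>) \<in> carrier (dual_numbers R)"
  by (simp add: dual_numbers_def)

text \<open>Read in the second component, this is the product rule for
  \<open>formal_deriv\<close>.\<close>

lemma eval_dual_numbers_mult:
  assumes p: "set p \<subseteq> carrier R" and q: "set q \<subseteq> carrier R" and x: "x \<in> carrier R"
  shows "ring.eval (dual_numbers R) (map (\<lambda>a. (a, \<zero>)) (poly_mult p q)) (x, \<one>) =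
    ring.eval (dual_numbers R) (map (\<lambda>a. (a, \<zero>)) p) (x, \<one>) \<otimes>\<^bsub>dual_numbers R\<^esub>
    ring.eval (dual_numbers R) (map (\<lambda>a. (a, \<zero>)) q) (x, \<one>)"
proof -
  interpret D: cring "dual_numbers R" by (rule dual_numbers_cring)
  let ?h = "\<lambda>a. (a, \<zero>)"
  interpret H: ring_hom_ring R "dual_numbers R" ?h
    by (rule ring_hom_ringI2[OF ring_axioms D.ring_axioms dual_numbers_hom])
  note hcl = dual_numbers_const_closed and x' = dual_numbers_root_closed[OF x]
  have "D.eval (map ?h (poly_mult p q)) (x, \<one>) = D.eval (D.normalize (map ?h (poly_mult p q))) (x, \<one>)"
    by (rule D.eval_normalize[symmetric, OF hcl[OF poly_mult_in_carrier[OF p q]] x'])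
  also have "\<dots> = D.eval (D.poly_mult (map ?h p) (map ?h q)) (x, \<one>)"
    by (simp only: H.poly_mult_hom'[OF p q])
  also have "\<dots> = D.eval (map ?h p) (x, \<one>) \<otimes>\<^bsub>dual_numbers R\<^esub> D.eval (map ?h q) (x, \<one>)"
    by (rule D.eval_poly_mult[OF hcl[OF p] hcl[OF q] x'])
  finally show ?thesis .
qed

end

section \<open>Multiple roots, vanishing derivatives and polynomials in a power of X\<close>

context field
begin

lemma eval_formal_deriv_multiple_root:
  assumes p: "p \<in> carrier (poly_ring R)" "p \<noteq> []" and a: "a \<in> carrier R" and m: "alg_mult p a \<ge> 2"
  shows "eval p a = \<zero>" "eval (formal_deriv p) a = \<zero>"
proof -
  interpret D: cring "dual_numbers R" by (rule dual_numbers_cring)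
  interpret UP: domain "poly_ring R" by (rule univ_poly_is_domain[OF carrier_is_subring])
  let ?b = "[\<one>, \<ominus> a]"
  have b: "?b \<in> carrier (poly_ring R)"
    using a unfolding univ_poly_carrier[symmetric] polynomial_def by simp
  have "(?b [^]\<^bsub>poly_ring R\<^esub> (2::nat)) pdivides p"
    by (rule le_alg_mult_imp_pdivides[OF a p(1) m])
  then obtain q where q: "q \<in> carrier (poly_ring R)" "p = (?b \<otimes>\<^bsub>poly_ring R\<^esub> ?b) \<otimes>\<^bsub>poly_ring R\<^esub> q"
    using b unfolding pdivides_def factor_def by (auto simp: numeral_2_eq_2)
  then have p': "p = poly_mult (poly_mult ?b ?b) q" by (simp add: univ_poly_mult)
  have cl: "set ?b \<subseteq> carrier R" "set q \<subseteq> carrier R" "set p \<subseteq> carrier R"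
    using a q(1) p(1) polynomial_incl unfolding univ_poly_carrier[symmetric] by auto
  have bb: "set (poly_mult ?b ?b) \<subseteq> carrier R" by (rule poly_mult_in_carrier[OF cl(1) cl(1)])
  let ?ev = "\<lambda>s. D.eval (map (\<lambda>a. (a, \<zero>)) s) (a, \<one>)"
  \<comment> \<open>X - a takes the value \<epsilon> at a + \<epsilon>; since \<epsilon> squares to
    zero, every multiple of (X - a)^2 vanishes there, in both components.\<close>
  have "?ev ?b = (\<zero>, \<one>)"
    unfolding eval_dual_numbers[OF cl(1) a] using a by (simp add: r_neg)
  then have "?ev (poly_mult ?b ?b) = (\<zero>, \<zero>)"
    unfolding eval_dual_numbers_mult[OF cl(1) cl(1) a] by (simp add: dual_numbers_def)
  moreover have "?ev q \<in> carrier (dual_numbers R)"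
    by (rule D.eval_in_carrier[OF dual_numbers_const_closed[OF cl(2)] dual_numbers_root_closed[OF a]])
  ultimately have "?ev (poly_mult (poly_mult ?b ?b) q) = (\<zero>, \<zero>)"
    unfolding eval_dual_numbers_mult[OF bb cl(2) a] by (auto simp: dual_numbers_def)
  then have "(eval p a, eval (formal_deriv p) a) = (\<zero>, \<zero>)"
    using eval_dual_numbers[OF cl(3) a] p' by metis
  then show "eval p a = \<zero>" "eval (formal_deriv p) a = \<zero>"
    by auto
qed

text \<open>A list that normalizes to \<open>[]\<close> consists of zeros, and the entries of the
  derivative are the exponents times the coefficients. The reversal makes the list position equal to
  the exponent.\<close>

lemma normalize_formal_deriv_Nil:
  assumes "set p \<subseteq> carrier R" "normalize (formal_deriv p) = []" "i < length p"
  shows "[i] \<cdot> (rev p ! i) = \<zero>"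
  using assms
proof (induction p rule: formal_deriv.induct)
  case (3 a b p)
  have h: "[length (b # p)] \<cdot> a = \<zero>" and n: "normalize (formal_deriv (b # p)) = []"
    using 3(3) by (auto split: if_splits)
  show ?case
  proof (cases "i < length (b # p)")
    case True
    then have "[i] \<cdot> (rev (b # p) ! i) = \<zero>" using 3 n by simp
    moreover have "rev (a # b # p) ! i = rev (b # p) ! i"
      using True by (simp add: nth_append)
    ultimately show ?thesis by simp
  next
    case False
    then have "i = length (b # p)" using 3(4) by simp
    then have "rev (a # b # p) ! i = a" by (simp add: nth_append)
    then show ?thesis using h \<open>i = length (b # p)\<close> by simp
  qed
qed auto

text \<open>\<open>g\<close> arises from \<open>p\<close> by dividing all exponents by
  \<open>q\<close>. The bound on \<open>q * degree g\<close> is carried through the induction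
  because it guarantees room for the next leading term; the clause on \<open>hd p\<close> excludes
  \<open>g = []\<close> for a nonzero polynomial.\<close>

lemma polynomial_in_power:
  assumes K: "subring K R" and q: "q > 0"
    and p: "set p \<subseteq> K" "\<And>i. i < length p \<Longrightarrow> rev p ! i \<noteq> \<zero> \<Longrightarrow> q dvd i"
  shows "\<exists>g \<in> carrier (K[X]). (g = [] \<or> q * degree g < length p) \<and>
    (p \<noteq> [] \<and> hd p \<noteq> \<zero> \<longrightarrow> g \<noteq> []) \<and>
    (\<forall>x\<in>carrier R. eval p x = eval g (x [^] q))"
  using p
proof (induction p)
  case Nil
  then show ?case by (intro bexI[of _ "[]"]) (auto simp: univ_poly_zero_closed)
next
  case (Cons c p)
  note sK = subringE[OF K]
  have ex: "q dvd i" if "i < length p" "rev p ! i \<noteq> \<zero>" for i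
    using Cons(3)[of i] that by (simp add: nth_append)
  obtain g where g: "g \<in> carrier (K[X])" "g = [] \<or> q * degree g < length p"
      "\<forall>x\<in>carrier R. eval p x = eval g (x [^] q)"
    using Cons.IH[OF _ ex] Cons.prems(1) by auto
  have gK: "set g \<subseteq> K"
    using g(1) polynomial_incl unfolding univ_poly_carrier[symmetric] by auto
  have gR: "set g \<subseteq> carrier R" using gK sK(1) by blast
  have pR: "set p \<subseteq> carrier R" "c \<in> carrier R" using Cons.prems(1) sK(1) by auto
  show ?case
  proof (cases "c = \<zero>")
    case True
    have "eval (c # p) x = eval p x" if "x \<in> carrier R" for x
      using True that eval_in_carrier[OF pR(1) that] by simp
    then show ?thesis using g True by (intro bexI[of _ g]) auto
  next
    case False
    then have "q dvd length p" using Cons(3)[of "length p"] by (simp add: nth_append)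
    then obtain m where m: "length p = q * m" ..
    have len: "length g \<le> m"
    proof (cases g)
      case (Cons a g')
      then show ?thesis using g(2) m q by auto
    qed simp
    \<comment> \<open>The exponent of \<open>c\<close> in \<open>p\<close> is
      \<open>length p = q * m\<close>, so in the new polynomial it must be \<open>m\<close>; zeros
      fill the gap above \<open>g\<close>.\<close>
    let ?g = "c # (replicate (m - length g) \<zero> @ g)"
    have "?g \<in> carrier (K[X])"
      using False gK Cons.prems(1) sK(2) unfolding univ_poly_carrier[symmetric] polynomial_def by auto
    moreover have "q * degree ?g < length (c # p)" using len m by simp
    moreover have "eval (c # p) x = eval ?g (x [^] q)" if x: "x \<in> carrier R" for x
      using g(3) x len eval_replicate[OF gR, of "x [^] q" "m - length g"] m
      by (simp add: nat_pow_pow)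
    ultimately show ?thesis by (intro bexI[of _ ?g]) auto
  qed
qed

section \<open>Binomial theorem, Frobenius map and characteristic\<close>

lemma binomial_expansion:
  assumes "a \<in> carrier R" "b \<in> carrier R"
  shows "(a \<oplus> b) [^] n = (\<Oplus>k\<in>{..n}. [(n choose k)] \<cdot> (a [^] k \<otimes> b [^] (n - k)))"
proof (induction n)
  case 0
  then show ?case using assms by simp
next
  case (Suc n)
  let ?t = "\<lambda>n k. [(n choose k)] \<cdot> (a [^] k \<otimes> b [^] (n - k))"
  have cl: "?t n k \<in> carrier R" for n k using assms by simp
  have A: "?t n k \<otimes> a = [(n choose k)] \<cdot> (a [^] Suc k \<otimes> b [^] (Suc n - Suc k))" for k
    using assms by (simp add: add_pow_ldistr add_pow_rdistr m_ac)
  have B: "?t n k \<otimes> b = [(n choose k)] \<cdot> (a [^] k \<otimes> b [^] (Suc n - k))" if "k \<le> n" for k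
    using assms that by (simp add: add_pow_ldistr m_assoc Suc_diff_le)
  \<comment> \<open>\<open>?u\<close> collects the terms multiplied by \<open>a\<close>, with the
    index moved up by one, and \<open>?v\<close> those multiplied by \<open>b\<close>; Pascal's rule
    adds them. Only \<open>?u (Suc k)\<close> enters the sums, so the truncation at 0 does not
    matter.\<close>
  let ?u = "\<lambda>k. [(n choose (k - 1))] \<cdot> (a [^] k \<otimes> b [^] (Suc n - k))"
  let ?v = "\<lambda>k. [(n choose k)] \<cdot> (a [^] k \<otimes> b [^] (Suc n - k))"
  have clu: "?u k \<in> carrier R" "?v k \<in> carrier R" for k using assms by auto
  have "(a \<oplus> b) [^] Suc n = (\<Oplus>k\<in>{..n}. ?t n k) \<otimes> a \<oplus> (\<Oplus>k\<in>{..n}. ?t n k) \<otimes> b"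
    using Suc assms cl by (simp add: r_distr)
  also have "(\<Oplus>k\<in>{..n}. ?t n k) \<otimes> a = (\<Oplus>k\<in>{..n}. ?u (Suc k))"
    using assms by (subst finsum_ldistr) (auto simp: A intro!: finsum_cong')
  also have "(\<Oplus>k\<in>{..n}. ?t n k) \<otimes> b = (\<Oplus>k\<in>{..n}. ?v k)"
    using assms by (subst finsum_ldistr) (auto simp: B intro!: finsum_cong')
  \<comment> \<open>The added top term is zero because \<open>n choose Suc n\<close> is 0.\<close>
  also have "\<dots> = (\<Oplus>k\<in>{..Suc n}. ?v k)"
    using clu assms by (subst finsum_Suc) (auto simp: binomial_eq_0)
  also have "\<dots> = (\<Oplus>k\<in>{..n}. ?v (Suc k)) \<oplus> ?v 0"
    by (rule finsum_Suc2) (use clu in auto)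
  also have "(\<Oplus>k\<in>{..n}. ?u (Suc k)) \<oplus> ((\<Oplus>k\<in>{..n}. ?v (Suc k)) \<oplus> ?v 0)
      = ((\<Oplus>k\<in>{..n}. ?u (Suc k)) \<oplus> (\<Oplus>k\<in>{..n}. ?v (Suc k))) \<oplus> ?v 0"
    using assms by (intro a_assoc[symmetric] finsum_closed) auto
  also have "(\<Oplus>k\<in>{..n}. ?u (Suc k)) \<oplus> (\<Oplus>k\<in>{..n}. ?v (Suc k)) = (\<Oplus>k\<in>{..n}. ?u (Suc k) \<oplus> ?v (Suc k))"
    using assms by (intro finsum_addf[symmetric]) auto
  also have "\<dots> = (\<Oplus>k\<in>{..n}. ?t (Suc n) (Suc k))"
  proof (rule finsum_cong')
    show "?u (Suc k) \<oplus> ?v (Suc k) = ?t (Suc n) (Suc k)" for k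
      using assms add.nat_pow_mult[of "a [^] Suc k \<otimes> b [^] (Suc n - Suc k)" "n choose k" "n choose Suc k"]
      by (simp del: nat_pow_Suc)
  qed (use assms in auto)
  also have "(\<Oplus>k\<in>{..n}. ?t (Suc n) (Suc k)) \<oplus> ?v 0 = (\<Oplus>k\<in>{..Suc n}. ?t (Suc n) k)"
    by (subst finsum_Suc2) (use cl assms in auto)
  finally show ?case .
qed

lemma frobenius_add:
  assumes q: "Factorial_Ring.prime (q::nat)" "[q] \<cdot> \<one> = \<zero>" and ab: "a \<in> carrier R" "b \<in> carrier R"
  shows "(a \<oplus> b) [^] q = a [^] q \<oplus> b [^] q"
proof -
  let ?t = "\<lambda>k. [(q choose k)] \<cdot> (a [^] k \<otimes> b [^] (q - k))"
  have cl: "?t k \<in> carrier R" for k using ab by simp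
  have z: "?t k = \<zero>" if k: "0 < k" "k < q" for k
  proof -
    have "q dvd (q choose k)" using dvd_choose_prime[of k q] q(1) k by simp
    then obtain m where m: "q choose k = q * m" ..
    have "[(q * m)] \<cdot> \<one> = [m] \<cdot> ([q] \<cdot> \<one>)"
      using add.nat_pow_pow[of \<one> m q] by simp
    then have "[(q choose k)] \<cdot> \<one> = \<zero>" using q(2) m by simp
    then show ?thesis
      using add_pow_ldistr[of \<one> "a [^] k \<otimes> b [^] (q - k)" "q choose k"] ab by simp
  qed
  have "q > 0" using q(1) prime_gt_0_nat by blast
  have "(a \<oplus> b) [^] q = (\<Oplus>k\<in>{..q}. ?t k)" by (rule binomial_expansion[OF ab])
  also have "\<dots> = (\<Oplus>k\<in>{0, q}. ?t k)"
    by (rule add.finprod_mono_neutral_cong_right) (use cl z in \<open>auto simp: not_less\<close>)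
  also have "\<dots> = a [^] q \<oplus> b [^] q"
    using \<open>q > 0\<close> ab by (simp add: a_comm)
  finally show ?thesis .
qed

lemma nat_pow_eq_zeroD:
  assumes "a \<in> carrier R" "a [^] (n::nat) = \<zero>" shows "a = \<zero>"
  using assms(2) by (induction n) (use assms(1) integral in auto)

lemma frobenius_inj:
  assumes q: "Factorial_Ring.prime (q::nat)" "[q] \<cdot> \<one> = \<zero>" and ab: "a \<in> carrier R" "b \<in> carrier R"
    and eq: "a [^] q = b [^] q"
  shows "a = b"
proof -
  \<comment> \<open>Additivity is applied to this sum rather than to a difference, so that no sign
    (-1)^q has to be evaluated.\<close>
  have "a = (a \<ominus> b) \<oplus> b" using ab by (simp add: a_minus_def a_assoc l_neg)
  then have "a [^] q = (a \<ominus> b) [^] q \<oplus> b [^] q"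
    using frobenius_add[OF q, of "a \<ominus> b" b] ab by simp
  then have "(a \<ominus> b) [^] q = \<zero>"
    using eq ab add.r_cancel_one'[of "b [^] q" "(a \<ominus> b) [^] q"] by simp
  then have "a \<ominus> b = \<zero>"
    using ab nat_pow_eq_zeroD by simp
  then show ?thesis using ab by (simp add: r_right_minus_eq)
qed

text \<open>The least positive annihilator of \<open>\<one>\<close> is the characteristic, prime
  since the field has no zero divisors. That it divides every annihilator will force the exponents
  of an inseparable minimal polynomial to be multiples of it.\<close>

lemma characteristic_prime:
  assumes "[(n::nat)] \<cdot> \<one> = \<zero>" "n > 0"
  obtains q :: nat where "Factorial_Ring.prime q" "[q] \<cdot> \<one> = \<zero>" "\<And>m::nat. [m] \<cdot> \<one> = \<zero> \<Longrightarrow> q dvd m"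
proof -
  define q where "q = (LEAST n::nat. n > 0 \<and> [n] \<cdot> \<one> = \<zero>)"
  have q: "q > 0" "[q] \<cdot> \<one> = \<zero>"
    using LeastI[of "\<lambda>n. n > 0 \<and> [n] \<cdot> \<one> = \<zero>" n] assms unfolding q_def by auto
  have min: "[m] \<cdot> \<one> \<noteq> \<zero>" if "0 < m" "m < q" for m :: nat
    using not_less_Least[of m "\<lambda>n. n > 0 \<and> [n] \<cdot> \<one> = \<zero>"] that unfolding q_def by auto
  have dvd: "q dvd m" if "[m] \<cdot> \<one> = \<zero>" for m :: nat
  proof -
    have "[m] \<cdot> \<one> = [(q * (m div q))] \<cdot> \<one> \<oplus> [(m mod q)] \<cdot> \<one>"
      using add.nat_pow_mult[of \<one> "q * (m div q)" "m mod q"] by simp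
    moreover have "[(q * (m div q))] \<cdot> \<one> = [(m div q)] \<cdot> ([q] \<cdot> \<one>)"
      using add.nat_pow_pow[of \<one> "m div q" q] by simp
    ultimately have "[(m mod q)] \<cdot> \<one> = \<zero>" using that q(2) by simp
    then have "m mod q = 0" using min[of "m mod q"] q(1) by auto
    then show ?thesis by auto
  qed
  have "Factorial_Ring.prime q"
  proof (rule prime_natI)
    show "q \<ge> 2"
    proof (rule ccontr)
      assume "\<not> q \<ge> 2"
      then have "q = 1" using q(1) by simp
      then show False using q(2) by simp
    qed
    fix a b assume "q dvd a * b"
    then obtain c where "a * b = q * c" ..
    then have "[(a * b)] \<cdot> \<one> = [c] \<cdot> ([q] \<cdot> \<one>)"
      using add.nat_pow_pow[of \<one> c q] by simp
    then have "([a] \<cdot> \<one>) \<otimes> ([b] \<cdot> \<one>) = \<zero>"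
      using q(2) add.nat_pow_pow[of \<one> b a] add_pow_rdistr[of "[a] \<cdot> \<one>" \<one> b] by simp
    then show "q dvd a \<or> q dvd b"
      using integral dvd by auto
  qed
  then show thesis using that q(2) dvd by blast
qed

end

section \<open>Descent along inseparable elements\<close>

context algebraically_closed
begin

text \<open>The minimal polynomial has the form g(X^q), so x^q is a root of \<open>g\<close>, of
  smaller degree. This strict drop is the measure for the descent that follows.\<close>

lemma inseparable_power:
  assumes K: "subfield K L" and x: "x \<in> carrier L" "(algebraic over K) x"
    and insep: "\<not> separable_element L K x"
  obtains q :: nat where "Factorial_Ring.prime q" "[q] \<cdot> \<one> = \<zero>"
    "(algebraic over K) (x [^] q)" "degree (Irr K (x [^] q)) < degree (Irr K x)"
proof -
  let ?f = "Irr K x"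
  note i = IrrE[OF K x]
  note sK = subfieldE(1)[OF K]
  have f: "?f \<in> carrier (poly_ring L)" "?f \<noteq> []"
    using carrier_polynomial_shell[OF sK i(1)] pirreducibleE(1)[OF sK i(1,2)] by auto
  have fK: "set ?f \<subseteq> K"
    using i(1) polynomial_incl unfolding univ_poly_carrier[symmetric] by auto
  then have fL: "set ?f \<subseteq> carrier L" using subfieldE(3)[OF K] by blast
  have deg: "degree ?f \<ge> 1" by (rule pirreducible_degree[OF K i(1,2)])
  obtain a where a: "a \<in> carrier L" "alg_mult ?f a \<ge> 2"
    using insep x(2) unfolding separable_element_def over_def
    by (auto simp: not_le Suc_le_eq numeral_2_eq_2)
  note root = eval_formal_deriv_multiple_root[OF f a]
  have a': "(algebraic over K) a" "Irr K a = ?f"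
    using Irr_eqI[OF K x a(1) root(1)] .
  let ?d = "normalize (formal_deriv ?f)"
  have dK: "set (formal_deriv ?f) \<subseteq> K" by (rule set_formal_deriv[OF sK fK])
  then have d: "?d \<in> carrier (K[X])"
    using normalize_gives_polynomial[OF dK] unfolding univ_poly_carrier by simp
  \<comment> \<open>The multiple root \<open>a\<close> has \<open>?f\<close> as its minimal
    polynomial and is a root of the derivative. A nonzero derivative would be divisible by
    \<open>?f\<close> although its degree is smaller.\<close>
  have d_nil: "?d = []"
  proof (rule ccontr)
    assume "?d \<noteq> []"
    have "eval ?d a = \<zero>"
      using eval_normalize[OF _ a(1)] dK subfieldE(3)[OF K] root(2) by auto
    then have "?f pdivides ?d"
      using Irr_minimal[OF K a(1) a'(1) d] a'(2) by simp
    then have "degree ?f \<le> degree ?d"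
      by (rule pdivides_imp_degree_le[OF sK i(1) d \<open>?d \<noteq> []\<close>])
    moreover have "length ?d \<le> length ?f - 1"
      using normalize_length_le[of "formal_deriv ?f"] length_formal_deriv by simp
    moreover have "length ?d > 0" using \<open>?d \<noteq> []\<close> by simp
    ultimately show False by linarith
  qed
  have z: "[j] \<cdot> \<one> = \<zero>" if j: "j < length ?f" "rev ?f ! j \<noteq> \<zero>" for j
  proof -
    have c: "rev ?f ! j \<in> carrier L"
      using j(1) fL by (metis length_rev nth_mem set_rev subsetD)
    have "([j] \<cdot> \<one>) \<otimes> (rev ?f ! j) = \<zero>"
      using normalize_formal_deriv_Nil[OF fL d_nil j(1)] add_pow_ldistr[of \<one> "rev ?f ! j" j] c by simp
    then show ?thesis using integral c j(2) by auto
  qed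
  \<comment> \<open>The leading coefficient is \<open>\<one>\<close>, hence nonzero, so the positive
    degree annihilates \<open>\<one>\<close>: the characteristic is positive.\<close>
  have "rev ?f ! degree ?f = hd ?f"
    using f(2) by (cases ?f) (auto simp: nth_append)
  then have "[degree ?f] \<cdot> \<one> = \<zero>"
    using z[of "degree ?f"] f(2) i(3) by simp
  then obtain q :: nat where q: "Factorial_Ring.prime q" "[q] \<cdot> \<one> = \<zero>"
      "\<And>m::nat. [m] \<cdot> \<one> = \<zero> \<Longrightarrow> q dvd m"
    using characteristic_prime deg by (metis less_le_trans zero_less_one)
  have q2: "q \<ge> 2" by (rule prime_ge_2_nat[OF q(1)])
  obtain g where g: "g \<in> carrier (K[X])" "g = [] \<or> q * degree g < length ?f" "g \<noteq> []"
      "\<forall>x\<in>carrier L. eval ?f x = eval g (x [^] q)"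
    using polynomial_in_power[OF sK _ fK, of q] q2 q(3) z f(2) i(3) by auto
  have xq: "x [^] q \<in> carrier L" "eval g (x [^] q) = \<zero>"
    using x(1) g(4) i(4) by auto
  have alg: "(algebraic over K) (x [^] q)"
    by (rule algebraicI[OF g(1,3) xq(2)])
  have "degree (Irr K (x [^] q)) \<le> degree g"
    using pdivides_imp_degree_le[OF sK IrrE(1)[OF K xq(1) alg] g(1,3)]
      Irr_minimal[OF K xq(1) alg g(1) xq(2)] by blast
  \<comment> \<open>The bound \<open>q * degree g < length ?f\<close> means at most
    \<open>degree ?f\<close>, whereas \<open>q \<ge> 2\<close> and a degree of at least 1 would make
    the product exceed it.\<close>
  also have "\<dots> < degree ?f"
  proof (rule ccontr)
    assume "\<not> degree g < degree ?f"
    then have "2 * degree ?f \<le> q * degree g" using q2 by (intro mult_le_mono) auto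
    then show False using g(2,3) deg by auto
  qed
  finally show thesis using that q(1,2) alg by blast
qed

text \<open>
  Descent along \<open>x, x\<^sup>q, x\<^bsup>q\<^sup>2\<^esup>, \<dots>\<close>: each inseparable power has a successor of smaller degree,
  and an embedding fixing the successor fixes the power since the Frobenius map is injective.
\<close>

lemma embedding_fixes_purely_inseparable:
  assumes KE: "finite_field_ext L K E" and \<phi>: "\<phi> \<in> embeddings L K E"
    and sep: "\<And>x. x \<in> E \<Longrightarrow> separable_element L K x \<Longrightarrow> x \<in> K"
    and x: "x \<in> E"
  shows "\<phi> x = x"
  using x
proof (induction "degree (Irr K x)" arbitrary: x rule: less_induct)
  case less
  note K = finite_field_extD[OF KE]
  show ?case
  proof (cases "separable_element L K x")
    case True
    then show ?thesis using sep[OF less(2)] embeddingsD(3)[OF \<phi>] by blast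
  next
    case False
    obtain q :: nat where q: "Factorial_Ring.prime q" "[q] \<cdot> \<one> = \<zero>"
        "degree (Irr K (x [^] q)) < degree (Irr K x)"
      using inseparable_power[OF K(1) K(8)[OF less(2)] K(7)[OF less(2)] False] by blast
    have pow: "x [^] n \<in> E \<and> \<phi> (x [^] n) = \<phi> x [^] n" for n :: nat
      using less(2) subringE(3,6)[OF subfieldE(1)[OF K(2)]]
        subfield_hom_one[OF K(2) embeddingsD(1)[OF \<phi>]]
        subfield_hom_mult[OF K(2) embeddingsD(1)[OF \<phi>]]
      by (induction n) auto
    have "\<phi> x [^] q = x [^] q"
      using less(1)[OF q(3)] pow[of q] by simp
    then show ?thesis
      using frobenius_inj[OF q(1,2)] K(8)[OF less(2)]
        subfield_hom_closed[OF K(2) embeddingsD(1)[OF \<phi>] less(2)] by blast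
  qed
qed

lemma card_embeddings_over_max_separable:
  assumes KE: "finite_field_ext L K E"
  shows "card (embeddings L (max_separable L K E) E) = 1"
proof -
  let ?S = "max_separable L K E"
  note SE = max_separable_ext(2)[OF KE]
  have fixed: "\<phi> x = x" if "\<phi> \<in> embeddings L ?S E" "x \<in> E" for \<phi> x
    using embedding_fixes_purely_inseparable[OF SE that(1) _ that(2)]
      separable_element_over_max_separable[OF KE] by blast
  have "\<phi> = \<psi>" if "\<phi> \<in> embeddings L ?S E" "\<psi> \<in> embeddings L ?S E" for \<phi> \<psi>
    by (rule embeddings_eqI[OF that]) (simp only: fixed[OF that(1)] fixed[OF that(2)])
  then have "card (embeddings L ?S E) \<le> 1"
    using card_le_Suc0_iff_eq[OF finite_embeddings[OF SE]] by auto
  then show ?thesis using card_embeddings_pos[OF SE] by simp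
qed

lemma card_embeddings_eq_dim_max_separable:
  assumes KE: "finite_field_ext L K E"
  shows "card (embeddings L K E) = dim K (max_separable L K E)"
  using card_embeddings_mult[OF KE max_separable_props(1-3)[OF KE]]
    card_embeddings_over_max_separable[OF KE]
    card_embeddings_eq_dim_iff[OF max_separable_ext(1)[OF KE]] max_separable_props(4)[OF KE] by simp

end

section \<open>Automorphisms, conjugates and fixed fields\<close>

lemma Bij_extensional_iff: "f \<in> Bij S \<longleftrightarrow> f \<in> extensional S \<and> inj_on f S \<and> f ` S = S"
  by (auto simp: Bij_def bij_betw_def)

section \<open>Automorphisms and conjugates inside the set of embeddings\<close>

context field
begin

text \<open>Brings automorphisms and isomorphisms onto conjugate fields into the one finite set
  \<open>embeddings\<close>, sorted by image.\<close>

lemma iso_over_iff: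
  assumes E: "subfield E R" and M: "subfield M R"
  shows "\<phi> \<in> iso_over R K E M \<longleftrightarrow> \<phi> \<in> embeddings R K E \<and> \<phi> ` E = M"
proof
  assume "\<phi> \<in> iso_over R K E M"
  then have \<phi>: "\<phi> \<in> ring_iso (R\<lparr>carrier := E\<rparr>) (R\<lparr>carrier := M\<rparr>)"
    and ext: "\<phi> \<in> extensional E" "\<forall>x\<in>K. \<phi> x = x"
    by (auto simp: iso_over_def)
  have "\<phi> \<in> ring_hom (R\<lparr>carrier := E\<rparr>) R"
    by (rule ring_hom_memI)
      (simp_all add: ring_iso_memE[OF \<phi>, simplified] subsetD[OF subfieldE(3)[OF M]])
  then show "\<phi> \<in> embeddings R K E \<and> \<phi> ` E = M"
    using ext ring_iso_memE(5)[OF \<phi>] by (auto simp: embeddings_def bij_betw_def)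
next
  assume \<phi>: "\<phi> \<in> embeddings R K E \<and> \<phi> ` E = M"
  then have h: "\<phi> \<in> ring_hom (R\<lparr>carrier := E\<rparr>) R" and e: "\<phi> \<in> extensional E" "\<forall>x\<in>K. \<phi> x = x"
    by (auto simp: embeddings_def)
  have "\<phi> \<in> ring_iso (R\<lparr>carrier := E\<rparr>) (R\<lparr>carrier := M\<rparr>)"
  proof (rule ring_iso_memI)
    show "\<phi> x \<in> carrier (R\<lparr>carrier := M\<rparr>)" if "x \<in> carrier (R\<lparr>carrier := E\<rparr>)" for x
      using that \<phi> by auto
    show "bij_betw \<phi> (carrier (R\<lparr>carrier := E\<rparr>)) (carrier (R\<lparr>carrier := M\<rparr>))"
      using subfield_hom_inj[OF E h] \<phi> by (simp add: bij_betw_def)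
  qed (simp_all add: ring_hom_memE[OF h, simplified])
  then show "\<phi> \<in> iso_over R K E M"
    using e by (simp add: iso_over_def)
qed

lemma Aut_over_iff:
  assumes "subfield E R"
  shows "\<phi> \<in> Aut_over R K E \<longleftrightarrow> \<phi> \<in> embeddings R K E \<and> \<phi> ` E = E"
  unfolding Aut_over_def by (rule iso_over_iff[OF assms assms])

lemma Aut_over_compose:
  assumes E: "subfield E R" and K: "K \<subseteq> E" and \<phi>: "\<phi> \<in> Aut_over R K E" and \<psi>: "\<psi> \<in> Aut_over R K E"
  shows "compose E \<phi> \<psi> \<in> Aut_over R K E"
proof -
  have "compose E \<phi> \<psi> \<in> embeddings R K E"
    using \<phi> \<psi> Aut_over_iff[OF E] by (intro compose_embeddings[OF E E _ _ _ K]) auto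
  moreover have "compose E \<phi> \<psi> ` E = E"
    using \<phi> \<psi> unfolding Aut_over_iff[OF E] by (metis surj_compose)
  ultimately show ?thesis unfolding Aut_over_iff[OF E] by blast
qed

text \<open>\<open>BijGroup E\<close> consists of the extensional bijections under
  \<open>compose\<close>, exactly the encoding used for embeddings. The group structure supplies the
  identity in each orbit and prepares Lagrange's theorem.\<close>

lemma Aut_over_subgroup:
  assumes KE: "finite_field_ext R K E"
  shows "subgroup (Aut_over R K E) (BijGroup E)"
proof -
  note K = finite_field_extD[OF KE]
  have bij: "\<phi> \<in> Bij E" if "\<phi> \<in> Aut_over R K E" for \<phi>
    using that subfield_hom_inj[OF K(2)] embeddingsD[of \<phi> R K E]
    unfolding Aut_over_iff[OF K(2)] Bij_extensional_iff by blast
  show ?thesis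
  proof (rule subgroup.intro)
    show "Aut_over R K E \<subseteq> carrier (BijGroup E)"
      using bij by (auto simp: BijGroup_def)
    show "\<phi> \<otimes>\<^bsub>BijGroup E\<^esub> \<psi> \<in> Aut_over R K E"
      if "\<phi> \<in> Aut_over R K E" "\<psi> \<in> Aut_over R K E" for \<phi> \<psi>
      using that bij Aut_over_compose[OF K(2,3)] by (simp add: BijGroup_def)
    show "\<one>\<^bsub>BijGroup E\<^esub> \<in> Aut_over R K E"
      using identity_embedding[OF K(2,3)] unfolding Aut_over_iff[OF K(2)] by (auto simp: BijGroup_def)
    fix \<phi> assume \<phi>: "\<phi> \<in> Aut_over R K E"
    then have \<phi>': "\<phi> \<in> embeddings R K E" "\<phi> ` E = E" unfolding Aut_over_iff[OF K(2)] by auto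
    have "restrict (inv_into E \<phi>) E \<in> Aut_over R K E"
      using inv_embeddings[OF K(2) \<phi>'(1) K(3), unfolded \<phi>'(2)]
      unfolding Aut_over_iff[OF K(2)] by blast
    then show "inv\<^bsub>BijGroup E\<^esub> \<phi> \<in> Aut_over R K E"
      using inv_BijGroup[OF bij[OF \<phi>]] by simp
  qed
qed

lemma finite_Aut_over:
  assumes "finite_field_ext R K E"
  shows "finite (Aut_over R K E)"
  using finite_subset[OF _ finite_embeddings[OF assms]] Aut_over_iff[OF finite_field_extD(2)[OF assms]]
  by blast

text \<open>Two embeddings with the same image differ by an automorphism of \<open>E\<close>,
  obtained by composing one with the inverse of the other.\<close>

lemma card_iso_over:
  assumes KE: "finite_field_ext R K E" and \<phi>: "\<phi> \<in> embeddings R K E"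
  shows "card {\<psi> \<in> embeddings R K E. \<psi> ` E = \<phi> ` E} = cluster_size R K E"
proof -
  note K = finite_field_extD[OF KE]
  let ?M = "\<phi> ` E"
  note M = subfield_hom_image[OF K(2) embeddingsD(1)[OF \<phi>]]
  have inj: "inj_on \<phi> E" by (rule subfield_hom_inj[OF K(2) embeddingsD(1)[OF \<phi>]])
  let ?g = "restrict (inv_into E \<phi>) ?M"
  note g = inv_embeddings[OF K(2) \<phi> K(3)]
  have KM: "K \<subseteq> ?M" using embeddingsD(3)[OF \<phi>] K(3) by force
  have "bij_betw (compose E \<phi>) (Aut_over R K E) {\<psi> \<in> embeddings R K E. \<psi> ` E = ?M}"
  proof (rule bij_betw_byWitness[where f' = "compose E ?g"])
    show "\<forall>\<psi>\<in>Aut_over R K E. compose E ?g (compose E \<phi> \<psi>) = \<psi>"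
    proof
      fix \<psi> assume "\<psi> \<in> Aut_over R K E"
      then have \<psi>: "\<psi> \<in> extensional E" "\<And>x. x \<in> E \<Longrightarrow> \<psi> x \<in> E"
        unfolding Aut_over_iff[OF K(2)] using embeddingsD(2) by auto
      show "compose E ?g (compose E \<phi> \<psi>) = \<psi>"
        by (rule extensionalityI[of _ E]) (use \<psi> inj in \<open>auto simp: compose_eq\<close>)
    qed
    show "\<forall>\<psi>\<in>{\<psi> \<in> embeddings R K E. \<psi> ` E = ?M}. compose E \<phi> (compose E ?g \<psi>) = \<psi>"
    proof
      fix \<psi> assume "\<psi> \<in> {\<psi> \<in> embeddings R K E. \<psi> ` E = ?M}"
      then have \<psi>: "\<psi> \<in> extensional E" "\<And>x. x \<in> E \<Longrightarrow> \<psi> x \<in> ?M"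
        using embeddingsD(2) by auto
      show "compose E \<phi> (compose E ?g \<psi>) = \<psi>"
        by (rule extensionalityI[of _ E]) (use \<psi> in \<open>simp_all add: compose_eq f_inv_into_f\<close>)
    qed
    show "compose E \<phi> ` Aut_over R K E \<subseteq> {\<psi> \<in> embeddings R K E. \<psi> ` E = ?M}"
    proof (rule image_subsetI)
      fix \<psi> assume "\<psi> \<in> Aut_over R K E"
      then have \<psi>: "\<psi> \<in> embeddings R K E" "\<psi> ` E = E"
        unfolding Aut_over_iff[OF K(2)] by auto
      have "compose E \<phi> \<psi> \<in> embeddings R K E"
        by (rule compose_embeddings[OF K(2,2) \<phi> \<psi>(1) _ K(3)]) (use \<psi>(2) in simp)
      moreover have "compose E \<phi> \<psi> ` E = ?M"
        using surj_compose[OF \<psi>(2), of \<phi> ?M] by simp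
      ultimately show "compose E \<phi> \<psi> \<in> {\<psi> \<in> embeddings R K E. \<psi> ` E = ?M}" by simp
    qed
    show "compose E ?g ` {\<psi> \<in> embeddings R K E. \<psi> ` E = ?M} \<subseteq> Aut_over R K E"
    proof (rule image_subsetI)
      fix \<psi> assume "\<psi> \<in> {\<psi> \<in> embeddings R K E. \<psi> ` E = ?M}"
      then have \<psi>: "\<psi> \<in> embeddings R K E" "\<psi> ` E = ?M" by auto
      have "compose E ?g \<psi> \<in> embeddings R K E"
        by (rule compose_embeddings[OF M K(2) g(1) \<psi>(1) _ K(3)]) (use \<psi>(2) in simp)
      moreover have "compose E ?g \<psi> ` E = E"
        by (rule surj_compose[OF \<psi>(2) g(2)])
      ultimately show "compose E ?g \<psi> \<in> Aut_over R K E"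
        unfolding Aut_over_iff[OF K(2)] by simp
    qed
  qed
  then show ?thesis unfolding cluster_size_def by (simp add: bij_betw_same_card)
qed

lemma cluster_size_mult_num_conjugates:
  assumes KE: "finite_field_ext R K E"
  shows "cluster_size R K E * num_conjugates R K E = card (embeddings R K E)"
proof -
  note K = finite_field_extD[OF KE]
  let ?C = "{M. subfield M R \<and> K \<subseteq> M \<and> iso_over R K E M \<noteq> {}}"
  \<comment> \<open>The conjugates index the fibres of the map sending an embedding to its image,
    and every fibre has the size of the automorphism group.\<close>
  have C: "?C = (\<lambda>\<phi>. \<phi> ` E) ` embeddings R K E"
  proof
    show "?C \<subseteq> (\<lambda>\<phi>. \<phi> ` E) ` embeddings R K E"
      using iso_over_iff[OF K(2)] by blast
    show "(\<lambda>\<phi>. \<phi> ` E) ` embeddings R K E \<subseteq> ?C"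
    proof (rule image_subsetI)
      fix \<phi> assume \<phi>: "\<phi> \<in> embeddings R K E"
      have "subfield (\<phi> ` E) R" by (rule subfield_hom_image[OF K(2) embeddingsD(1)[OF \<phi>]])
      moreover have "K \<subseteq> \<phi> ` E" using embeddingsD(3)[OF \<phi>] K(3) by force
      ultimately show "\<phi> ` E \<in> ?C" using iso_over_iff[OF K(2)] \<phi> by blast
    qed
  qed
  let ?fib = "\<lambda>M. {\<psi> \<in> embeddings R K E. \<psi> ` E = M}"
  have fin: "finite (embeddings R K E)" by (rule finite_embeddings[OF KE])
  have "embeddings R K E = (\<Union>M\<in>?C. ?fib M)" unfolding C by auto
  then have "card (embeddings R K E) = card (\<Union>M\<in>?C. ?fib M)" by simp
  also have "\<dots> = (\<Sum>M\<in>?C. card (?fib M))"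
    by (rule card_UN_disjoint) (use fin in \<open>auto simp: C\<close>)
  also have "\<dots> = (\<Sum>M\<in>?C. cluster_size R K E)"
    by (rule sum.cong) (use card_iso_over[OF KE] in \<open>auto simp: C\<close>)
  finally show ?thesis by (simp add: num_conjugates_def mult.commute)
qed

end

section \<open>Normal extensions\<close>

context algebraically_closed
begin

text \<open>The root multiset computed in \<open>E\<close> is contained in the one computed in
  \<open>L\<close>, and both have size \<open>degree p\<close>. Hence they agree, and the closure
  contributes no further roots.\<close>

lemma splitted_subfield_root:
  assumes E: "subfield E L" and p: "p \<in> carrier (E[X])" "p \<noteq> []"
    and split: "ring.splitted (L\<lparr>carrier := E\<rparr>) p"
    and b: "b \<in> carrier L" "eval p b = \<zero>"
  shows "b \<in> E"
proof -
  interpret F: field "L\<lparr>carrier := E\<rparr>" by (rule subfield_iff(2)[OF E])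
  have PE: "univ_poly (L\<lparr>carrier := E\<rparr>) E = E[X]"
    using univ_poly_consistent[OF subfieldE(1)[OF E]] by metis
  have pF: "p \<in> carrier (univ_poly (L\<lparr>carrier := E\<rparr>) (carrier (L\<lparr>carrier := E\<rparr>)))"
    using p(1) PE by simp
  have pL: "p \<in> carrier (poly_ring L)" by (rule carrier_polynomial_shell[OF subfieldE(1)[OF E] p(1)])
  have sub: "carrier (E[X]) \<subseteq> carrier (poly_ring L)"
    using carrier_polynomial_shell[OF subfieldE(1)[OF E]] by blast
  \<comment> \<open>Multiplication of coefficient lists is the same operation over either
    coefficient ring, so divisibility by a power carries over.\<close>
  have pow: "q [^]\<^bsub>E[X]\<^esub> n = q [^]\<^bsub>poly_ring L\<^esub> n" for q and n :: nat
    by (simp add: nat_pow_def univ_poly_mult univ_poly_one)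
  have le: "F.alg_mult p a \<le> alg_mult p a" for a
  proof (cases "a \<in> E")
    case True
    then have a: "a \<in> carrier L" using subfieldE(3)[OF E] by blast
    have neg: "\<ominus>\<^bsub>L\<lparr>carrier := E\<rparr>\<^esub> a = \<ominus> a"
    proof -
      have "\<ominus>\<^bsub>L\<lparr>carrier := E\<rparr>\<^esub> a \<oplus> a = \<zero>" "\<ominus>\<^bsub>L\<lparr>carrier := E\<rparr>\<^esub> a \<in> E"
        using F.l_neg[of a] F.a_inv_closed[of a] True by auto
      then show ?thesis using minus_equality a subfieldE(3)[OF E] by auto
    qed
    have "([\<one>, \<ominus> a] [^]\<^bsub>E[X]\<^esub> F.alg_mult p a) divides\<^bsub>E[X]\<^esub> p"
      using F.alg_multE(1)[of a p] True pF p(2) unfolding pdivides_def by (simp add: neg PE)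
    then have "([\<one>, \<ominus> a] [^]\<^bsub>poly_ring L\<^esub> F.alg_mult p a) pdivides p"
      using sub unfolding pdivides_def factor_def pow univ_poly_mult by blast
    then show ?thesis by (rule alg_multE(2)[OF a pL p(2)])
  next
    case False
    then show ?thesis unfolding F.alg_mult_def by simp
  qed
  have "F.roots p \<subseteq># roots p"
    using le unfolding subseteq_mset_def
    by (simp add: F.alg_mult_eq_count_roots[OF pF, symmetric] alg_mult_eq_count_roots[OF pL, symmetric])
  moreover have "size (F.roots p) = size (roots p)"
    using split roots_over_carrier[OF pL] by (simp add: F.splitted_def splitted_def)
  ultimately have "F.roots p = roots p"
    using mset_subset_size[of "F.roots p" "roots p"] by (auto simp: subset_mset_def)
  moreover have "b \<in># roots p"
    using roots_mem_iff_is_root[OF pL] b p(2) by (simp add: is_root_def)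
  ultimately show ?thesis
    using F.roots_mem_iff_is_root[OF pF] by (simp add: F.is_root_def)
qed

lemma normal_ext_embedding_image:
  assumes KE: "finite_field_ext L K E" and normal: "normal_ext L K E"
    and \<phi>: "\<phi> \<in> embeddings L K E"
  shows "\<phi> ` E = E"
proof (rule embedding_image_eq[OF KE \<phi>])
  note K = finite_field_extD[OF KE]
  show "\<phi> ` E \<subseteq> E"
  proof (rule image_subsetI)
    fix x assume x: "x \<in> E"
    note i = IrrE[OF K(1) K(8)[OF x] K(7)[OF x]]
    have "ring.splitted (L\<lparr>carrier := E\<rparr>) (Irr K x)"
      using normal i x unfolding normal_ext_def by blast
    moreover have "Irr K x \<in> carrier (E[X])"
      using i(1) K(3) unfolding univ_poly_carrier[symmetric] polynomial_def by auto
    moreover have "Irr K x \<noteq> []"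
      by (rule pirreducibleE(1)[OF subfieldE(1)[OF K(1)] i(1,2)])
    ultimately show "\<phi> x \<in> E"
      using splitted_subfield_root[OF K(2)] embeddings_Irr_root[OF KE \<phi> x] by blast
  qed
qed

lemma normal_ext_Aut_over:
  assumes "finite_field_ext L K E" "normal_ext L K E"
  shows "Aut_over L K E = embeddings L K E"
  using normal_ext_embedding_image[OF assms] Aut_over_iff[OF finite_field_extD(2)[OF assms(1)]] by blast

text \<open>Normality turns all embeddings into automorphisms; separability makes their number the
  degree.\<close>

lemma galois_cluster_size:
  assumes "finite_field_ext L K E" "galois_ext L K E"
  shows "cluster_size L K E = dim K E"
  using assms card_embeddings_eq_dim_iff[OF assms(1)] normal_ext_Aut_over[OF assms(1)]
  unfolding galois_ext_def cluster_size_def by simp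

lemma normal_ext_num_conjugates:
  assumes KE: "finite_field_ext L K E" and normal: "normal_ext L K E"
  shows "num_conjugates L K E = 1"
proof -
  have "cluster_size L K E * num_conjugates L K E = cluster_size L K E"
    using cluster_size_mult_num_conjugates[OF KE] normal_ext_Aut_over[OF assms]
    by (simp add: cluster_size_def)
  moreover have "cluster_size L K E > 0"
    using card_embeddings_pos[OF KE] normal_ext_Aut_over[OF assms] by (simp add: cluster_size_def)
  ultimately show ?thesis by simp
qed

section \<open>Fixed fields and Artin's theorem\<close>

lemma fixed_field_subfield:
  assumes KE: "finite_field_ext L K E" and A: "A \<subseteq> embeddings L K E"
  shows "subfield (fixed_field E A) L" "K \<subseteq> fixed_field E A" "fixed_field E A \<subseteq> E"
proof -
  note K = finite_field_extD[OF KE]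
  let ?Q = "\<lambda>\<phi>. {x \<in> E. \<phi> x = x}"
  have id: "(\<lambda>x. x) \<in> ring_hom (L\<lparr>carrier := E\<rparr>) L"
    by (rule ring_hom_memI) (use K(5) in auto)
  have Q: "subfield (?Q \<phi>) L" if "\<phi> \<in> A" for \<phi>
    using subfield_hom_equalizer_subfield[OF K(2) embeddingsD(1) id, of \<phi> K] that A by blast
  note sE = subringE[OF subfieldE(1)[OF K(2)]]
  note sQ = subringE[OF subfieldE(1)[OF Q]]
  show "subfield (fixed_field E A) L"
  proof (rule subfieldI'[OF subringI])
    show "fixed_field E A \<subseteq> carrier L" using K(5) by (auto simp: fixed_field_def)
    show "\<one> \<in> fixed_field E A" using sE(3) sQ(3) by (auto simp: fixed_field_def)
    fix x assume x: "x \<in> fixed_field E A"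
    show "\<ominus> x \<in> fixed_field E A" using x sE(5) sQ(5)[of _ x] by (auto simp: fixed_field_def)
    fix y assume y: "y \<in> fixed_field E A"
    show "x \<otimes> y \<in> fixed_field E A" "x \<oplus> y \<in> fixed_field E A"
      using x y sE(6,7) sQ(6,7)[of _ x y] by (auto simp: fixed_field_def)
  next
    fix x assume x: "x \<in> fixed_field E A - {\<zero>}"
    have "inv x \<in> E" using subfield_m_inv(1)[OF K(2), of x] x by (auto simp: fixed_field_def)
    moreover have "\<phi> (inv x) = inv x" if "\<phi> \<in> A" for \<phi>
      using subfield_m_inv(1)[OF Q[OF that], of x] x that by (auto simp: fixed_field_def)
    ultimately show "inv x \<in> fixed_field E A" by (simp add: fixed_field_def)
  qed
  have "\<phi> x = x" if "\<phi> \<in> A" "x \<in> K" for \<phi> x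
    using embeddingsD(3)[of \<phi> L K E x] that A by blast
  then show "K \<subseteq> fixed_field E A" "fixed_field E A \<subseteq> E"
    using K(3) by (auto simp: fixed_field_def)
qed

text \<open>The product of the factors X - b over \<open>B\<close>. The leading coefficient is split
  off so that invariance concerns only tails of the fixed length \<open>card B\<close>, the form
  that \<open>eval_eq_imp_eq\<close> compares.\<close>

lemma exists_monic_with_roots:
  assumes E: "subfield E L" and B: "finite B" "B \<subseteq> E"
  shows "\<exists>t. set t \<subseteq> E \<and> length t = card B \<and> (\<forall>b\<in>B. eval (\<one> # t) b = \<zero>)"
  using B
proof (induction B rule: finite_induct)
  case empty
  then show ?case by (intro exI[of _ "[]"]) auto
next
  case (insert a B)
  note sE = subringE[OF subfieldE(1)[OF E]]
  obtain t where t: "set t \<subseteq> E" "length t = card B" "\<forall>b\<in>B. eval (\<one> # t) b = \<zero>"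
    using insert by auto
  let ?b = "[\<one>, \<ominus> a]"
  let ?p = "poly_mult ?b (\<one> # t)"
  have a: "a \<in> E" "a \<in> carrier L" using insert sE(1) by auto
  have b: "polynomial E ?b" "polynomial E (\<one> # t)"
    using a(1) t(1) sE(3,5) by (auto simp: polynomial_def)
  have p: "polynomial E ?p" by (rule poly_mult_closed[OF subfieldE(1)[OF E] b])
  have cl: "set ?b \<subseteq> carrier L" "set (\<one> # t) \<subseteq> carrier L"
    using a t(1) sE(1) by auto
  have deg: "degree ?p = Suc (card B)"
    using poly_mult_degree_eq[OF subfieldE(1)[OF E] b] t(2) by simp
  have lead: "lead_coeff ?p = \<one>"
    using poly_mult_lead_coeff[OF subfieldE(1)[OF E] b] by simp
  have "?p \<noteq> []" using deg by auto
  then obtain t' where t': "?p = \<one> # t'" using lead by (cases ?p) auto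
  have "eval ?p c = \<zero>" if c: "c \<in> insert a B" for c
  proof -
    have cL: "c \<in> carrier L" using c insert.prems sE(1) by blast
    have "eval ?p c = eval ?b c \<otimes> eval (\<one> # t) c"
      by (rule eval_poly_mult[OF cl cL])
    moreover have "eval ?b a = \<zero>" using a(2) by (simp add: r_neg)
    moreover have "eval ?b c \<in> carrier L" "eval (\<one> # t) c \<in> carrier L"
      using eval_in_carrier[OF cl(1) cL] eval_in_carrier[OF cl(2) cL] by auto
    ultimately show ?thesis using c t(3) by auto
  qed
  moreover have "set t' \<subseteq> E" using polynomial_incl[OF p] unfolding t' by simp
  moreover have "length t' = card (insert a B)" using deg insert unfolding t' by simp
  ultimately show ?case unfolding t' by blast
qed

text \<open>The difference has degree below \<open>card B\<close> but vanishes on all of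
  \<open>B\<close>, so it is zero.\<close>

lemma eval_eq_imp_eq:
  assumes t: "set t \<subseteq> carrier L" "set s \<subseteq> carrier L" "length t = length s"
    and B: "B \<subseteq> carrier L" "length t \<le> card B" "\<And>b. b \<in> B \<Longrightarrow> eval t b = eval s b"
  shows "t = s"
proof -
  interpret UP: domain "poly_ring L" by (rule univ_poly_is_domain[OF carrier_is_subring])
  let ?p = "normalize t" and ?q = "normalize s"
  have p: "?p \<in> carrier (poly_ring L)" "?q \<in> carrier (poly_ring L)"
    using normalize_gives_polynomial[OF t(1)] normalize_gives_polynomial[OF t(2)]
    unfolding univ_poly_carrier by auto
  let ?d = "?p \<ominus>\<^bsub>poly_ring L\<^esub> ?q"
  have d: "?d \<in> carrier (poly_ring L)" using p by simp
  have "?d = []"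
  proof (rule ccontr)
    assume ne: "?d \<noteq> []"
    have "eval ?d b = \<zero>" if b: "b \<in> B" for b
    proof -
      have bL: "b \<in> carrier L" using b B(1) by blast
      interpret ev: ring_hom_ring "poly_ring L" L "\<lambda>p. eval p b"
        by (rule eval_ring_hom[OF carrier_is_subring bL])
      have "eval ?d b = eval ?p b \<ominus> eval ?q b"
        using p by (simp add: a_minus_def)
      also have "\<dots> = eval t b \<ominus> eval s b"
        using eval_normalize[OF t(1) bL] eval_normalize[OF t(2) bL] by simp
      finally show ?thesis
        using B(3)[OF b] eval_in_carrier[OF t(2) bL] by (simp add: a_minus_def r_neg)
    qed
    then have "B \<subseteq> {b \<in> carrier L. eval ?d b = \<zero>}" using B(1) by auto
    moreover have "{b \<in> carrier L. eval ?d b = \<zero>} = {b. is_root ?d b}"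
      using ne by (auto simp: is_root_def)
    ultimately have "card B \<le> card {b \<in> carrier L. eval ?d b = \<zero>}"
      using finite_number_of_roots[OF d] by (intro card_mono) auto
    also have "\<dots> \<le> degree ?d" by (rule card_roots(1)[OF d ne])
    finally have "length t \<le> length ?d - 1" using B(2) by simp
    moreover have "length ?d > 0" using ne by simp
    moreover have "length ?d \<le> length t"
    proof -
      have "length (\<ominus>\<^bsub>poly_ring L\<^esub> ?q) = length ?q"
        by (rule univ_poly_a_inv_length[OF carrier_is_subring p(2)])
      then have "length ?d \<le> max (length ?p) (length ?q)"
        using poly_add_length_le[of ?p "\<ominus>\<^bsub>poly_ring L\<^esub> ?q"]
        unfolding a_minus_def univ_poly_add by simp
      then show ?thesis
        using normalize_length_le[of t] normalize_length_le[of s] t(3) by simp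
    qed
    ultimately show False by linarith
  qed
  then have "?p = ?q"
    using UP.r_right_minus_eq[OF p] by (simp add: univ_poly_zero)
  \<comment> \<open>A list is its normal form padded with leading zeros, so equal normal forms and
    equal lengths give equal lists.\<close>
  then show ?thesis
    using normalize_trick[of t] normalize_trick[of s] t(3) by simp
qed

text \<open>
  The monic polynomial of degree \<open>card B\<close> vanishing on the orbit \<open>B\<close> is unique, hence invariant.
\<close>

lemma orbit_polynomial:
  assumes KE: "finite_field_ext L K E" and x: "x \<in> E"
  defines "A \<equiv> Aut_over L K E"
  obtains h where "h \<in> carrier ((fixed_field E A)[X])" "h \<noteq> []" "eval h x = \<zero>"
    "degree h = card ((\<lambda>\<phi>. \<phi> x) ` A)" "\<And>b. b \<in> (\<lambda>\<phi>. \<phi> x) ` A \<Longrightarrow> eval h b = \<zero>"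
proof -
  note K = finite_field_extD[OF KE]
  let ?B = "(\<lambda>\<phi>. \<phi> x) ` A"
  have A: "\<phi> \<in> embeddings L K E" "\<phi> ` E = E" if "\<phi> \<in> A" for \<phi>
    using that unfolding A_def Aut_over_iff[OF K(2)] by auto
  have B: "finite ?B" "?B \<subseteq> E"
    using finite_Aut_over[OF KE] A(2) x unfolding A_def by auto
  then have BL: "?B \<subseteq> carrier L" using K(5) by blast
  obtain t where t: "set t \<subseteq> E" "length t = card ?B" "\<forall>b\<in>?B. eval (\<one> # t) b = \<zero>"
    using exists_monic_with_roots[OF K(2) B] by blast
  have tL: "set t \<subseteq> carrier L" using t(1) K(5) by blast
  have "map \<phi> t = t" if \<phi>: "\<phi> \<in> A" for \<phi>
  proof (rule eval_eq_imp_eq[where B = ?B])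
    note h = embeddingsD(1)[OF A(1)[OF \<phi>]]
    show "set (map \<phi> t) \<subseteq> carrier L"
      using t(1) subfield_hom_closed[OF K(2) h] by auto
    have sub: "\<phi> ` ?B \<subseteq> ?B"
    proof
      fix c assume "c \<in> \<phi> ` ?B"
      then obtain \<psi> where \<psi>: "\<psi> \<in> A" "c = \<phi> (\<psi> x)" by auto
      have "compose E \<phi> \<psi> \<in> A"
        using Aut_over_compose[OF K(2,3)] \<phi> \<psi>(1) unfolding A_def by blast
      moreover have "c = compose E \<phi> \<psi> x" using \<psi>(2) x by (simp add: compose_eq)
      ultimately show "c \<in> ?B" by blast
    qed
    \<comment> \<open>Surjectivity on the orbit is needed because the transported polynomial is
      evaluated at points \<open>\<phi> c\<close>, and these must exhaust the orbit.\<close>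
    have onto: "\<phi> ` ?B = ?B"
      by (rule endo_inj_surj[OF B(1) sub inj_on_subset[OF subfield_hom_inj[OF K(2) h] B(2)]])
    fix b assume b: "b \<in> ?B"
    then obtain c where c: "c \<in> ?B" "b = \<phi> c" using onto by blast
    have bL: "b \<in> carrier L" using b BL by blast
    have "eval (map \<phi> (\<one> # t)) b = \<phi> (eval (\<one> # t) c)"
      using subfield_hom_eval[OF K(2) h, of "\<one> # t" c] t(1) c B(2)
        subringE(3)[OF subfieldE(1)[OF K(2)]] by auto
    also have "\<dots> = \<zero>" by (simp only: bspec[OF t(3) c(1)] subfield_hom_zero[OF K(2) h])
    finally have 1: "b [^] length t \<oplus> eval (map \<phi> t) b = \<zero>"
      using subfield_hom_one[OF K(2) h] bL by simp
    have 2: "b [^] length t \<oplus> eval t b = \<zero>"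
      using bspec[OF t(3) b] bL by simp
    have cl: "eval (map \<phi> t) b \<in> carrier L" "eval t b \<in> carrier L"
      using eval_in_carrier[OF \<open>set (map \<phi> t) \<subseteq> carrier L\<close> bL] eval_in_carrier[OF tL bL] by auto
    \<comment> \<open>Both monic polynomials vanish at \<open>b\<close> and share their leading
      term, so their tails have equal values.\<close>
    have "b [^] length t \<oplus> eval (map \<phi> t) b = b [^] length t \<oplus> eval t b"
      using 1 2 by simp
    then show "eval (map \<phi> t) b = eval t b"
      using cl bL by simp
  qed (use tL BL t(2) in auto)
  then have "c \<in> fixed_field E A" if "c \<in> set t" for c
    using that t(1) map_eq_conv[of _ t "\<lambda>c. c"] unfolding fixed_field_def by auto
  moreover have "subfield (fixed_field E A) L"
    by (rule fixed_field_subfield(1)[OF KE]) (use A(1) in blast)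
  then have "\<one> \<in> fixed_field E A" by (rule subringE(3)[OF subfieldE(1)])
  ultimately have "\<one> # t \<in> carrier ((fixed_field E A)[X])"
    unfolding univ_poly_carrier[symmetric] polynomial_def by auto
  moreover have "x \<in> ?B"
  proof -
    have "\<one>\<^bsub>BijGroup E\<^esub> \<in> A"
      using subgroup.one_closed[OF Aut_over_subgroup[OF KE]] unfolding A_def .
    then have "(\<lambda>x\<in>E. x) \<in> A" by (simp add: BijGroup_def)
    then show ?thesis using x by (intro image_eqI[of _ _ "\<lambda>x\<in>E. x"]) auto
  qed
  ultimately show thesis
    using that[of "\<one> # t"] t(2,3) by auto
qed

lemma fixed_field_Aut_over:
  assumes KE: "finite_field_ext L K E"
  defines "F \<equiv> fixed_field E (Aut_over L K E)"
  shows "finite_field_ext L K F" "finite_field_ext L F E" "Aut_over L F E = Aut_over L K E"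
proof -
  note K = finite_field_extD[OF KE]
  have A: "Aut_over L K E \<subseteq> embeddings L K E" using Aut_over_iff[OF K(2)] by blast
  note F = fixed_field_subfield[OF KE A, folded F_def]
  show "finite_field_ext L K F" "finite_field_ext L F E"
    using finite_field_ext_lower[OF KE F] finite_field_ext_upper[OF KE F] .
  have 1: "embeddings L F E \<subseteq> embeddings L K E" by (rule embeddings_antimono[OF F(2)])
  have 2: "\<phi> \<in> embeddings L F E" if "\<phi> \<in> Aut_over L K E" for \<phi>
    using that A unfolding embeddings_def F_def fixed_field_def by auto
  show "Aut_over L F E = Aut_over L K E"
  proof (rule Set.set_eqI)
    show "\<phi> \<in> Aut_over L F E \<longleftrightarrow> \<phi> \<in> Aut_over L K E" for \<phi>
      using 1 2[of \<phi>] Aut_over_iff[OF K(2), of \<phi> F] Aut_over_iff[OF K(2), of \<phi> K] by blast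
  qed
qed

text \<open>The orbit polynomial of \<open>x\<close> has the fixed field as coefficient field and
  has as many distinct roots in \<open>E\<close> as its degree. An irreducible polynomial with root
  \<open>x\<close> divides it, so it inherits simple roots and splits in \<open>E\<close>.\<close>

lemma galois_fixed_field:
  assumes KE: "finite_field_ext L K E"
  defines "F \<equiv> fixed_field E (Aut_over L K E)"
  shows "galois_ext L F E"
proof -
  note K = finite_field_extD[OF KE]
  note FE = fixed_field_Aut_over(2)[OF KE, folded F_def]
  note F = finite_field_extD[OF FE]
  interpret SE: field "L\<lparr>carrier := E\<rparr>" by (rule subfield_iff(2)[OF K(2)])
  have PE: "univ_poly (L\<lparr>carrier := E\<rparr>) E = E[X]"
    using univ_poly_consistent[OF subfieldE(1)[OF K(2)]] by metis
  have FXE: "carrier (F[X]) \<subseteq> carrier (E[X])"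
  proof
    fix p assume "p \<in> carrier (F[X])"
    then have "polynomial E p"
      using F(3) unfolding univ_poly_carrier[symmetric] polynomial_def by blast
    then show "p \<in> carrier (E[X])" unfolding univ_poly_carrier .
  qed
  let ?B = "\<lambda>x. (\<lambda>\<phi>. \<phi> x) ` Aut_over L K E"
  have BE: "finite (?B x)" "?B x \<subseteq> E" if "x \<in> E" for x
    using that finite_Aut_over[OF KE] Aut_over_iff[OF K(2)] by auto
  have "separable_element L F x" if x: "x \<in> E" for x
  proof -
    obtain h where h: "h \<in> carrier (F[X])" "h \<noteq> []" "eval h x = \<zero>" "degree h = card (?B x)"
        "\<And>b. b \<in> ?B x \<Longrightarrow> eval h b = \<zero>"
      using orbit_polynomial[OF KE x] unfolding F_def by blast
    have hL: "h \<in> carrier (poly_ring L)"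
      by (rule carrier_polynomial_shell[OF subfieldE(1)[OF F(1)] h(1)])
    note Fx = F(1) F(8)[OF x] F(7)[OF x]
    note i = IrrE[OF Fx]
    have iL: "Irr F x \<in> carrier (poly_ring L)"
      by (rule carrier_polynomial_shell[OF subfieldE(1)[OF F(1)] i(1)])
    have "{b \<in> carrier L. eval h b = \<zero>} = {b. is_root h b}"
      using h(2) by (auto simp: is_root_def)
    \<comment> \<open>The orbit alone supplies \<open>degree h\<close> distinct roots, so all roots
      of \<open>h\<close> are simple.\<close>
    then have "card (?B x) \<le> card {b \<in> carrier L. eval h b = \<zero>}"
      using finite_number_of_roots[OF hL] h(5) BE(2)[OF x] K(5) by (intro card_mono) auto
    then have "card {b \<in> carrier L. eval h b = \<zero>} = degree h"
      using card_roots(1)[OF hL h(2)] h(4) by simp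
    then have 1: "alg_mult h a \<le> 1" if "a \<in> carrier L" for a
      using card_roots(2)[OF hL h(2)] that by blast
    have "Irr F x pdivides h" by (rule Irr_minimal[OF Fx h(1,3)])
    then have "roots (Irr F x) \<subseteq># roots h"
      by (rule pdivides_imp_roots_incl[OF iL hL h(2)])
    then have "alg_mult (Irr F x) a \<le> alg_mult h a" for a
      using alg_mult_eq_count_roots[OF iL] alg_mult_eq_count_roots[OF hL]
      by (simp add: mset_subset_eq_count)
    then show ?thesis
      using 1 F(7)[OF x] unfolding separable_element_def over_def by (meson le_trans)
  qed
  moreover have "SE.splitted p"
    if p: "p \<in> carrier (F[X])" "pirreducible F p" and x: "x \<in> E" "eval p x = \<zero>" for p x
  proof -
    interpret UP: domain "F[X]" by (rule univ_poly_is_domain[OF subfieldE(1)[OF F(1)]])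
    obtain h where h: "h \<in> carrier (F[X])" "h \<noteq> []" "eval h x = \<zero>" "degree h = card (?B x)"
        "\<And>b. b \<in> ?B x \<Longrightarrow> eval h b = \<zero>"
      using orbit_polynomial[OF KE x(1)] unfolding F_def by blast
    note Fx = F(1) F(8)[OF x(1)] F(7)[OF x(1)]
    note i = IrrE[OF Fx]
    obtain q where q: "q \<in> carrier (F[X])" "p = Irr F x \<otimes>\<^bsub>F[X]\<^esub> q"
      using Irr_divides[OF Fx p(1) x(2)] .
    \<comment> \<open>Irreducibility of \<open>p\<close> makes the cofactor \<open>q\<close> a unit,
      so \<open>p\<close> divides whatever \<open>Irr F x\<close> divides, in particular the orbit
      polynomial.\<close>
    have "Irr F x \<notin> Units (F[X])"
      by (rule pirreducibleE(2)[OF subfieldE(1)[OF F(1)] i(1,2)])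
    then have "q \<in> Units (F[X])"
      using pirreducibleE(3)[OF subfieldE(1)[OF F(1)] p i(1) q(1) q(2)] by blast
    then obtain q' where q': "q' \<in> carrier (F[X])" "q \<otimes>\<^bsub>F[X]\<^esub> q' = \<one>\<^bsub>F[X]\<^esub>"
      unfolding Units_def by auto
    obtain s where s: "s \<in> carrier (F[X])" "h = Irr F x \<otimes>\<^bsub>F[X]\<^esub> s"
      using Irr_divides[OF Fx h(1,3)] .
    have "h = p \<otimes>\<^bsub>F[X]\<^esub> (q' \<otimes>\<^bsub>F[X]\<^esub> s)"
    proof -
      have "p \<otimes>\<^bsub>F[X]\<^esub> (q' \<otimes>\<^bsub>F[X]\<^esub> s) = Irr F x \<otimes>\<^bsub>F[X]\<^esub> ((q \<otimes>\<^bsub>F[X]\<^esub> q') \<otimes>\<^bsub>F[X]\<^esub> s)"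
        unfolding q(2) using i(1) q(1) q'(1) s(1) by (simp add: UP.m_assoc)
      then show ?thesis using q'(2) s i(1) by simp
    qed
    moreover have "q' \<otimes>\<^bsub>F[X]\<^esub> s \<in> carrier (E[X])"
      using q'(1) s(1) FXE by auto
    ultimately have "p pdivides\<^bsub>L\<lparr>carrier := E\<rparr>\<^esub> h"
      unfolding pdivides_def factor_def by (auto simp: PE univ_poly_mult)
    moreover have pE: "p \<in> carrier (univ_poly (L\<lparr>carrier := E\<rparr>) (carrier (L\<lparr>carrier := E\<rparr>)))"
      and hE: "h \<in> carrier (univ_poly (L\<lparr>carrier := E\<rparr>) (carrier (L\<lparr>carrier := E\<rparr>)))"
      using p(1) h(1) FXE PE by auto
    moreover have "SE.splitted h"
    proof -
      have "?B x \<subseteq> set_mset (SE.roots h)"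
      proof
        fix b assume b: "b \<in> ?B x"
        then have "SE.eval h b = \<zero>"
          using h(5) eval_consistent[OF subfieldE(1)[OF K(2)]] by simp
        then show "b \<in># SE.roots h"
          using SE.roots_mem_iff_is_root[OF hE] b BE(2)[OF x(1)] h(2) by (auto simp: SE.is_root_def)
      qed
      then have "degree h \<le> card (set_mset (SE.roots h))"
        unfolding h(4) by (intro card_mono) auto
      also have "\<dots> \<le> size (SE.roots h)" by (rule card_set_mset_le_size)
      finally show ?thesis
        using SE.size_roots_le_degree[OF hE] by (simp add: SE.splitted_def)
    qed
    ultimately show ?thesis using SE.pdivides_imp_splitted[OF pE hE h(2)] by blast
  qed
  ultimately show ?thesis
    using F(7) unfolding galois_ext_def normal_ext_def separable_ext_def over_def by blast
qed

text \<open>Over the fixed field the extension is Galois and has the same automorphisms as over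
  \<open>K\<close>, so the number of these is the degree.\<close>

lemma cluster_size_eq_dim_fixed_field:
  assumes "finite_field_ext L K E"
  shows "cluster_size L K E = dim (fixed_field E (Aut_over L K E)) E"
  using galois_cluster_size[OF fixed_field_Aut_over(2)[OF assms] galois_fixed_field[OF assms]]
    fixed_field_Aut_over(3)[OF assms] by (simp add: cluster_size_def)

text \<open>For Galois E/M the degree is the order of Aut(E/M), which lies in Aut(E/K). If the
  orders agree, the groups coincide, so Aut(E/K) fixes \<open>M\<close> and \<open>M\<close> lies in
  the fixed field.\<close>

lemma cluster_size_le_dim_galois:
  assumes KE: "finite_field_ext L K E" and M: "subfield M L" "K \<subseteq> M" "M \<subseteq> E"
    and galois: "galois_ext L M E"
  shows "dim M E \<le> cluster_size L K E"
    and "dim M E = cluster_size L K E \<Longrightarrow> M = fixed_field E (Aut_over L K E)"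
proof -
  note K = finite_field_extD[OF KE]
  note ME = finite_field_ext_upper[OF KE M]
  let ?F = "fixed_field E (Aut_over L K E)"
  have sub: "Aut_over L M E \<subseteq> Aut_over L K E"
    using embeddings_antimono[OF M(2)] Aut_over_iff[OF K(2)] by blast
  have d: "dim M E = card (Aut_over L M E)"
    using galois_cluster_size[OF ME galois] by (simp add: cluster_size_def)
  show "dim M E \<le> cluster_size L K E"
    unfolding d cluster_size_def by (rule card_mono[OF finite_Aut_over[OF KE] sub])
  assume eq: "dim M E = cluster_size L K E"
  then have "Aut_over L M E = Aut_over L K E"
    using card_subset_eq[OF finite_Aut_over[OF KE] sub] d by (simp add: cluster_size_def)
  then have fix_M: "\<phi> x = x" if "\<phi> \<in> Aut_over L K E" "x \<in> M" for \<phi> x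
    using that Aut_over_iff[OF K(2), of \<phi> M] embeddingsD(3)[of \<phi> L M E x] by simp
  have MF: "M \<subseteq> ?F"
    using M(3) fix_M unfolding fixed_field_def by blast
  note F = fixed_field_Aut_over(1,2)[OF KE]
  have MF': "finite_field_ext L M ?F"
    by (rule finite_field_ext_lower[OF ME finite_field_extD(1)[OF F(2)] MF finite_field_extD(3)[OF F(2)]])
  have "dim M E = dim M ?F * dim ?F E" by (rule finite_field_ext_trans(2)[OF MF' F(2)])
  \<comment> \<open>The degrees of \<open>E\<close> over \<open>M\<close> and over the fixed field
    are equal and positive, so they cancel in the tower.\<close>
  then have "dim M ?F = 1"
    using eq cluster_size_eq_dim_fixed_field[OF KE] finite_field_ext_dim_pos[OF F(2)] by simp
  then show "M = ?F" using finite_field_ext_dim_1[OF MF'] by simp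
qed

text \<open>An embedding of the fixed field extends to \<open>E\<close>, where normality makes it an
  automorphism, and automorphisms fix the fixed field. So this field is purely inseparable over
  \<open>K\<close>.\<close>

lemma normal_ext_embeddings_fixed_field:
  assumes KE: "finite_field_ext L K E" and normal: "normal_ext L K E"
  shows "card (embeddings L K (fixed_field E (Aut_over L K E))) = 1"
proof -
  let ?F = "fixed_field E (Aut_over L K E)"
  note K = finite_field_extD[OF KE]
  note KF = fixed_field_Aut_over(1)[OF KE] and FE = fixed_field_Aut_over(2)[OF KE]
  have "\<phi> x = x" if \<phi>: "\<phi> \<in> embeddings L K ?F" and x: "x \<in> ?F" for \<phi> x
  proof -
    obtain \<psi> where \<psi>: "\<psi> \<in> embeddings L K E" "restrict \<psi> ?F = \<phi>"
      using extend_embedding[OF KE _ _ _ \<phi>] finite_field_extD(2,3)[OF KF] finite_field_extD(3)[OF FE]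
      by blast
    then have "\<psi> \<in> Aut_over L K E" using normal_ext_Aut_over[OF assms] by simp
    then have "\<psi> x = x" using x unfolding fixed_field_def by blast
    then show ?thesis using \<psi>(2) x by auto
  qed
  then have "embeddings L K ?F \<subseteq> {\<lambda>x\<in>?F. x}"
    using embeddingsD(2) by (fastforce intro!: extensionalityI[of _ ?F])
  then have "card (embeddings L K ?F) \<le> 1"
    using card_mono[of "{\<lambda>x\<in>?F. x}"] by fastforce
  then show ?thesis using card_embeddings_pos[OF KF] by simp
qed

section \<open>Restriction to the maximal separable subextension\<close>

lemma Aut_over_restrict_max_separable:
  assumes KE: "finite_field_ext L K E" and \<phi>: "\<phi> \<in> Aut_over L K E"
  shows "restrict \<phi> (max_separable L K E) \<in> Aut_over L K (max_separable L K E)"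
    and "\<phi> ` max_separable L K E \<subseteq> max_separable L K E"
proof -
  note K = finite_field_extD[OF KE]
  let ?S = "max_separable L K E"
  note S = max_separable_props[OF KE] and KS = max_separable_ext(1)[OF KE]
  have \<phi>': "\<phi> \<in> embeddings L K E" "\<phi> ` E = E" using \<phi> unfolding Aut_over_iff[OF K(2)] by auto
  show im: "\<phi> ` ?S \<subseteq> ?S"
  proof (rule image_subsetI)
    fix x assume "x \<in> ?S"
    then have x: "x \<in> E" "separable_element L K x" unfolding max_separable_eq[OF KE] by auto
    note r = embeddings_Irr_root[OF KE \<phi>'(1) x(1)]
    \<comment> \<open>The image of a separable element has the same minimal polynomial, so it is
      separable too.\<close>
    note i = Irr_eqI[OF K(1) K(8)[OF x(1)] K(7)[OF x(1)] r(2,1)]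
    have "separable_element L K (\<phi> x)"
      using x(2) i unfolding separable_element_def over_def by simp
    then show "\<phi> x \<in> ?S" unfolding max_separable_eq[OF KE] using x(1) \<phi>'(2) by blast
  qed
  have e: "restrict \<phi> ?S \<in> embeddings L K ?S"
    by (rule restrict_embeddings[OF S(1) K(2) S(3) \<phi>'(1) S(2)])
  have "restrict \<phi> ?S ` ?S = ?S"
    by (rule embedding_image_eq[OF KS e]) (use im in auto)
  with e show "restrict \<phi> ?S \<in> Aut_over L K ?S" unfolding Aut_over_iff[OF S(1)] by blast
qed

text \<open>Restriction is onto because embeddings extend, and both sets have the same size since
  only one embedding fixes the maximal separable subfield. A surjection between finite sets of equal
  size is injective.\<close>

lemma inj_on_restrict_max_separable:
  assumes KE: "finite_field_ext L K E"
  shows "inj_on (\<lambda>\<phi>. restrict \<phi> (max_separable L K E)) (embeddings L K E)"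
proof (rule eq_card_imp_inj_on[OF finite_embeddings[OF KE]])
  note K = finite_field_extD[OF KE] and S = max_separable_props[OF KE]
  let ?S = "max_separable L K E"
  have "(\<lambda>\<phi>. restrict \<phi> ?S) ` embeddings L K E = embeddings L K ?S"
  proof
    show "(\<lambda>\<phi>. restrict \<phi> ?S) ` embeddings L K E \<subseteq> embeddings L K ?S"
      using restrict_embeddings[OF S(1) K(2) S(3) _ S(2)] by blast
    show "embeddings L K ?S \<subseteq> (\<lambda>\<phi>. restrict \<phi> ?S) ` embeddings L K E"
      using extend_embedding[OF KE S(1-3)] by blast
  qed
  then show "card ((\<lambda>\<phi>. restrict \<phi> ?S) ` embeddings L K E) = card (embeddings L K E)"
    using card_embeddings_mult[OF KE S(1-3)] card_embeddings_over_max_separable[OF KE] by simp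
qed

lemma cluster_size_dvd_max_separable:
  assumes KE: "finite_field_ext L K E"
  shows "cluster_size L K E dvd cluster_size L K (max_separable L K E)"
proof -
  note K = finite_field_extD[OF KE] and S = max_separable_props[OF KE]
  let ?S = "max_separable L K E"
  let ?A = "Aut_over L K E" and ?B = "Aut_over L K ?S"
  note sA = Aut_over_subgroup[OF KE] and sB = Aut_over_subgroup[OF max_separable_ext(1)[OF KE]]
  let ?GA = "BijGroup E\<lparr>carrier := ?A\<rparr>" and ?GB = "BijGroup ?S\<lparr>carrier := ?B\<rparr>"
  have gA: "group ?GA" and gB: "group ?GB"
    using group.subgroup_imp_group[OF group_BijGroup] sA sB by auto
  let ?r = "\<lambda>\<phi>. restrict \<phi> ?S"
  have bA: "\<phi> \<in> Bij E" if "\<phi> \<in> ?A" for \<phi>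
    using subgroup.subset[OF sA] that by (auto simp: BijGroup_def)
  have bB: "\<phi> \<in> Bij ?S" if "\<phi> \<in> ?B" for \<phi>
    using subgroup.subset[OF sB] that by (auto simp: BijGroup_def)
  note r = Aut_over_restrict_max_separable[OF KE]
  have "?r \<in> hom ?GA ?GB"
  proof (rule homI)
    show "?r \<phi> \<in> carrier ?GB" if "\<phi> \<in> carrier ?GA" for \<phi> using that r(1) by simp
    fix \<phi> \<psi> assume "\<phi> \<in> carrier ?GA" "\<psi> \<in> carrier ?GA"
    then have \<phi>: "\<phi> \<in> ?A" "\<psi> \<in> ?A" by auto
    have "?r (compose E \<phi> \<psi>) = compose ?S (?r \<phi>) (?r \<psi>)"
      using r(2)[OF \<phi>(2)] S(3) by (auto simp: compose_def restrict_def fun_eq_iff)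
    then show "?r (\<phi> \<otimes>\<^bsub>?GA\<^esub> \<psi>) = ?r \<phi> \<otimes>\<^bsub>?GB\<^esub> ?r \<psi>"
      using \<phi> bA bB r(1) by (simp add: BijGroup_def)
  qed
  then interpret H: group_hom ?GA ?GB ?r
    using gA gB by (simp add: group_hom_def group_hom_axioms_def)
  \<comment> \<open>Lagrange's theorem for the image of restriction, whose order is that of
    \<open>?A\<close> by injectivity.\<close>
  have "card (?r ` ?A) dvd card ?B"
    using group.lagrange[OF gB H.img_is_subgroup] by (simp add: order_def) (metis dvd_triv_right)
  moreover have "card (?r ` ?A) = card ?A"
    using Aut_over_iff[OF K(2)]
    by (intro card_image inj_on_subset[OF inj_on_restrict_max_separable[OF KE]]) blast
  ultimately show ?thesis by (simp add: cluster_size_def)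
qed

end

section \<open>Degree arithmetic for the five assertions\<close>

theorem proposition2p8:
  fixes C :: "('a, 'b) ring_scheme" (structure)
    and K L L\<^sub>S L\<^sub>A :: "'a set" and A :: "('a \<Rightarrow> 'a) set"
  assumes "algebraic_closure C K"
    and "finite_field_ext C K L"
  defines "L\<^sub>S \<equiv> max_separable C K L"
    and "A \<equiv> Aut_over C K L"
    and "L\<^sub>A \<equiv> fixed_field L A"
  shows
    \<comment> \<open>(1)\<close>
    "(cluster_size C K L = ring.dim C L\<^sub>A L \<and>
      (\<forall>N. (intermediate_field C K N L \<and> galois_ext C N L \<and>
            (\<forall>M. intermediate_field C K M L \<and> galois_ext C M L \<longrightarrow>
                 ring.dim C M L \<le> ring.dim C N L))
           \<longleftrightarrow> N = L\<^sub>A)) \<and>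
     \<comment> \<open>(2)\<close>
     (multicluster_size C K L\<^sub>S = cluster_size C K L\<^sub>S \<and>
      cluster_size C L\<^sub>S L = 1 \<and> num_conjugates C L\<^sub>S L = 1 \<and>
      multicluster_size C L\<^sub>S L = ring.dim C L\<^sub>S L) \<and>
     \<comment> \<open>(3)\<close>
     (cluster_size C K L * num_conjugates C K L = ring.dim C K L\<^sub>S \<and>
      multicluster_size C K L * num_conjugates C K L = ring.dim C K L \<and>
      ring.dim C K L\<^sub>A = ring.dim C L\<^sub>S L * num_conjugates C K L) \<and>
     \<comment> \<open>(4)\<close>
     (cluster_size C K L dvd cluster_size C K L\<^sub>S \<and>
      num_conjugates C K L\<^sub>S dvd num_conjugates C K L) \<and>
     \<comment> \<open>(5)\<close>
     (normal_ext C K L \<longrightarrow>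
       (cluster_size C K L\<^sub>S = ring.dim C K L\<^sub>S \<and> num_conjugates C K L\<^sub>S = 1) \<and>
       (cluster_size C K L = cluster_size C K L\<^sub>S \<and>
        multicluster_size C K L = ring.dim C K L \<and> num_conjugates C K L = 1) \<and>
       (cluster_size C K L\<^sub>A = 1 \<and> num_conjugates C K L\<^sub>A = 1 \<and>
        multicluster_size C K L\<^sub>A = ring.dim C K L\<^sub>A))"
proof -
  interpret C: algebraic_closure C K by fact
  note KL = assms(2)
  note K = C.finite_field_extD[OF KL]
  have LS: "L\<^sub>S = max_separable C K L" and A: "A = Aut_over C K L" and LA: "L\<^sub>A = fixed_field L A"
    by (simp_all add: assms)
  note LA' = LA[unfolded A]
  note S = C.max_separable_props[OF KL, folded LS] and KS = C.max_separable_ext(1)[OF KL, folded LS]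
    and SL = C.max_separable_ext(2)[OF KL, folded LS]
  note KA = C.fixed_field_Aut_over(1)[OF KL, folded LA'] and AL = C.fixed_field_Aut_over(2)[OF KL, folded LA']
  have r_eq: "cluster_size C K L = C.dim L\<^sub>A L"
    using C.cluster_size_eq_dim_fixed_field[OF KL] unfolding LA' .
  have galA: "galois_ext C L\<^sub>A L"
    using C.galois_fixed_field[OF KL] unfolding LA' .
  have intA: "intermediate_field C K L\<^sub>A L"
    using C.finite_field_extD(2,3)[OF KA] C.finite_field_extD(3)[OF AL] by (simp add: intermediate_field_def)
  have galois_le: "C.dim M L \<le> C.dim L\<^sub>A L" "C.dim M L = C.dim L\<^sub>A L \<Longrightarrow> M = L\<^sub>A"
    if "intermediate_field C K M L" "galois_ext C M L" for M
  proof -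
    have M: "subfield M C" "K \<subseteq> M" "M \<subseteq> L"
      using that(1) by (auto simp: intermediate_field_def)
    note le = C.cluster_size_le_dim_galois[OF KL M that(2), folded LA', unfolded r_eq]
    show "C.dim M L \<le> C.dim L\<^sub>A L" by (rule le(1))
    show "C.dim M L = C.dim L\<^sub>A L \<Longrightarrow> M = L\<^sub>A" by (rule le(2))
  qed
  have unique: "(intermediate_field C K N L \<and> galois_ext C N L \<and>
      (\<forall>M. intermediate_field C K M L \<and> galois_ext C M L \<longrightarrow> C.dim M L \<le> C.dim N L)) \<longleftrightarrow> N = L\<^sub>A"
    for N
  proof
    assume "N = L\<^sub>A"
    then show "intermediate_field C K N L \<and> galois_ext C N L \<and>
      (\<forall>M. intermediate_field C K M L \<and> galois_ext C M L \<longrightarrow> C.dim M L \<le> C.dim N L)"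
      using intA galA galois_le(1) by simp
  next
    assume N: "intermediate_field C K N L \<and> galois_ext C N L \<and>
      (\<forall>M. intermediate_field C K M L \<and> galois_ext C M L \<longrightarrow> C.dim M L \<le> C.dim N L)"
    then have "C.dim L\<^sub>A L \<le> C.dim N L" using intA galA by simp
    with N show "N = L\<^sub>A" using galois_le[of N] by simp
  qed

  have r_s: "cluster_size C K L * num_conjugates C K L = C.dim K L\<^sub>S"
    using C.cluster_size_mult_num_conjugates[OF KL] C.card_embeddings_eq_dim_max_separable[OF KL]
    unfolding LS by simp
  \<comment> \<open>L_S is its own maximal separable subextension, so the degree factor in its
    multicluster size is 1 and the embedding count is its full degree.\<close>
  have max_S: "max_separable C K L\<^sub>S = L\<^sub>S"
    unfolding C.max_separable_eq[OF KS] using S(4) by (auto simp: separable_ext_def)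
  have r_s_S: "cluster_size C K L\<^sub>S * num_conjugates C K L\<^sub>S = C.dim K L\<^sub>S"
    using C.cluster_size_mult_num_conjugates[OF KS] C.card_embeddings_eq_dim_max_separable[OF KS]
    unfolding max_S by simp
  have max_SL: "max_separable C L\<^sub>S L = L\<^sub>S"
    using C.max_separable_props(2)[OF SL] C.separable_element_over_max_separable[OF KL, folded LS]
    unfolding C.max_separable_eq[OF SL] by blast
  have l_S: "multicluster_size C K L\<^sub>S = cluster_size C K L\<^sub>S"
    unfolding multicluster_size_def max_S using C.finite_field_ext_refl(2)[OF S(1)] by simp
  \<comment> \<open>There is a single embedding over L_S, and a product of naturals equal to 1 has
    both factors equal to 1.\<close>
  have "cluster_size C L\<^sub>S L * num_conjugates C L\<^sub>S L = 1"
    using C.cluster_size_mult_num_conjugates[OF SL] C.card_embeddings_over_max_separable[OF KL]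
    unfolding LS by simp
  then have r_s_SL: "cluster_size C L\<^sub>S L = 1" "num_conjugates C L\<^sub>S L = 1" by simp_all
  have l_SL: "multicluster_size C L\<^sub>S L = C.dim L\<^sub>S L"
    unfolding multicluster_size_def max_SL using r_s_SL by simp

  have tower_S: "C.dim K L = C.dim K L\<^sub>S * C.dim L\<^sub>S L"
    by (rule C.finite_field_ext_trans(2)[OF KS SL])
  have tower_A: "C.dim K L = C.dim K L\<^sub>A * C.dim L\<^sub>A L"
    by (rule C.finite_field_ext_trans(2)[OF KA AL])
  have l_eq: "multicluster_size C K L = C.dim L\<^sub>S L * cluster_size C K L"
    by (simp add: multicluster_size_def LS)
  have l_s: "multicluster_size C K L * num_conjugates C K L = C.dim K L"
    unfolding l_eq tower_S r_s[symmetric] by simp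
  have pos: "cluster_size C K L > 0" "cluster_size C K L\<^sub>S > 0"
    using C.finite_field_ext_dim_pos[OF KS] r_s r_s_S by (auto intro: Nat.gr0I)
  \<comment> \<open>[L:K] is factored through L^A and through L_S; the common positive factor r_K(L)
    is then cancelled.\<close>
  have "C.dim K L\<^sub>A * cluster_size C K L = C.dim K L"
    unfolding tower_A r_eq ..
  also have "\<dots> = (C.dim L\<^sub>S L * num_conjugates C K L) * cluster_size C K L"
    unfolding tower_S r_s[symmetric] by (simp only: ac_simps)
  finally have dim_A: "C.dim K L\<^sub>A = C.dim L\<^sub>S L * num_conjugates C K L"
    using pos by simp

  have r_dvd: "cluster_size C K L dvd cluster_size C K L\<^sub>S"
    using C.cluster_size_dvd_max_separable[OF KL] unfolding LS .
  then obtain c where c: "cluster_size C K L\<^sub>S = cluster_size C K L * c" ..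
  \<comment> \<open>[L_S:K] is the product of cluster size and conjugate number both for L and for
    L_S; cancelling r_K(L) shows that the quotient \<open>c\<close> of the cluster sizes is also the
    quotient of the conjugate numbers, taken the other way round.\<close>
  have "cluster_size C K L * num_conjugates C K L = cluster_size C K L * (c * num_conjugates C K L\<^sub>S)"
    unfolding r_s r_s_S[symmetric] c by (rule mult.assoc)
  then have "num_conjugates C K L = c * num_conjugates C K L\<^sub>S"
    using pos by simp
  then have s_dvd: "num_conjugates C K L\<^sub>S dvd num_conjugates C K L" by simp

  have normal: "(cluster_size C K L\<^sub>S = C.dim K L\<^sub>S \<and> num_conjugates C K L\<^sub>S = 1) \<and>
      (cluster_size C K L = cluster_size C K L\<^sub>S \<and>
       multicluster_size C K L = C.dim K L \<and> num_conjugates C K L = 1) \<and>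
      (cluster_size C K L\<^sub>A = 1 \<and> num_conjugates C K L\<^sub>A = 1 \<and>
       multicluster_size C K L\<^sub>A = C.dim K L\<^sub>A)"
    if n: "normal_ext C K L"
  proof -
    have s: "num_conjugates C K L = 1" by (rule C.normal_ext_num_conjugates[OF KL n])
    then have s_S: "num_conjugates C K L\<^sub>S = 1" using s_dvd by simp
    have one: "card (embeddings C K L\<^sub>A) = 1"
      using C.normal_ext_embeddings_fixed_field[OF KL n] unfolding LA' .
    then have rA: "cluster_size C K L\<^sub>A = 1" "num_conjugates C K L\<^sub>A = 1"
      using C.cluster_size_mult_num_conjugates[OF KA] by simp_all
    \<comment> \<open>With one embedding the separable part of L^A over K has degree 1, so the
      degree factor of the multicluster size is the whole of [L^A:K].\<close>
    have "C.dim K (max_separable C K L\<^sub>A) = 1"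
      using C.card_embeddings_eq_dim_max_separable[OF KA] one by simp
    then have "multicluster_size C K L\<^sub>A = C.dim K L\<^sub>A"
      using C.finite_field_ext_trans(2)[OF C.max_separable_ext[OF KA]] rA
      by (simp add: multicluster_size_def)
    then show ?thesis using s s_S rA r_s r_s_S l_s by simp
  qed
  show ?thesis
    using r_eq unique l_S r_s_SL l_SL r_s l_s dim_A r_dvd s_dvd normal by blast
qed

end
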